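(* Let $U,V_1,\dots,V_L$ be jointly Gaussian, mean zero, with $\mathbb E[U^2]=\mathbb E[V_\ell^2]=1$, $\mathbb E[UV_\ell]=\rho^2$ and $\mathbb E[V_\ell V_{\ell'}]=\rho^4$ for $\ell\ne\ell'$. Let $(\bm x,\bm x_1,\dots,\bm x_L)$ be the label vectors defined in the context and $(\bm x',\bm x_1',\dots,\bm x_L')$ an independent copy. Then for any $\alpha,\alpha_1,\dots,\alpha_L\in\mathbb N$, $$\mathbb E\left[\Big(\tfrac{\langle\bm x,\bm x'\rangle}{\sqrt n}\Big)^{2\alpha}\Big(\tfrac{\langle\bm x_1,\bm x_1'\rangle}{\sqrt n}\Big)^{2\alpha_1}\cdots\Big(\tfrac{\langle\bm x_L,\bm x_L'\rangle}{\sqrt n}\Big)^{2\alpha_L}\right]\le\mathbb E\left[U^{2\alpha}V_1^{2\alpha_1}\cdots V_L^{2\alpha_L}\right].$$ In particular, for every $|t|\le\iota$, $$\mathbb E\left[\exp\Big(\tfrac{(1+t)^2\mu^2}{2\gamma}\big(\tfrac{\langle\bm x,\bm x'\rangle}{\sqrt n}\big)^2+\sum_{\ell=1}^L\tfrac{\epsilon_\ell^2\lambda_\ell}{2}\big(\tfrac{\langle\bm x_\ell,\bm x_\ell'\rangle}{\sqrt n}\big)^2\Big)\right]\le\mathbb E\left[\exp\Big(\tfrac{(1+t)^2\mu^2}{2\gamma}U^2+\sum_{\ell=1}^L\tfrac{\epsilon_\ell^2\lambda_\ell}{2}V_\ell^2\Big)\right].$$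
   Context: $n,L\ge1$ are integers; $\mu>0$, $\rho\in(0,1]$, $\gamma>0$, $\lambda_\ell>0$, $\epsilon_\ell\in(0,1)$ ($1\le\ell\le L$) are constants. The label vectors: $\bm x$ is uniform on $\{-1,+1\}^n$; independently, $\bm z_1,\dots,\bm z_L\in\{-1,+1\}^n$ have all entries independent with $\Pr(\bm z_\ell(i)=1)=\frac{1+\rho}2$; $\bm x_\ell(i)=\bm x(i)\bm z_\ell(i)$. $\langle\cdot,\cdot\rangle$ is the Euclidean inner product. Standing setting for the last assertion: $\max\big\{\frac{\mu^2}\gamma,\max_\ell\epsilon_\ell^2\lambda_\ell,\frac{\mu^2}\gamma+\sum_{\ell}\frac{\rho^4\epsilon_\ell^2\lambda_\ell}{1-(1-\rho^4)\epsilon_\ell^2\lambda_\ell}\big\}\le1-\delta$ for some constant $\delta>0$, and $\iota\in(0,1)$ is a small constant with $\frac{(1+\iota)^2\mu^2}{\gamma}<1$ and $\frac{(1+\iota)^2\mu^2}\gamma+\sum_{\ell}\frac{\rho^4\epsilon_\ell^2\lambda_\ell}{1-(1-\rho^4)\epsilon_\ell^2\lambda_\ell}<1$. *)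

theory Defs
  imports "HOL-Probability.Probability"
begin

definition inner_prod :: "nat \<Rightarrow> (nat \<Rightarrow> real) \<Rightarrow> (nat \<Rightarrow> real) \<Rightarrow> real" where
  "inner_prod n u v = (\<Sum>i<n. u i * v i)"

definition sign_pmf :: "real \<Rightarrow> real pmf" where
  "sign_pmf \<rho> = map_pmf (\<lambda>b. if b then 1 else -1) (bernoulli_pmf ((1 + \<rho>) / 2))"

text \<open>
  Joint law of the label vectors \<open>(x, x\<^sub>1, \<dots>, x\<^sub>L)\<close>.
  Vectors of length \<open>n\<close> are functions on \<open>{..<n}\<close>; the second component is the family
  \<open>\<ell> \<mapsto> x\<^sub>\<ell>\<close>, meaningful for \<open>\<ell> \<in> {1..L}\<close> only.
\<close>
definition label_pmf :: "nat \<Rightarrow> nat \<Rightarrow> real \<Rightarrow> ((nat \<Rightarrow> real) \<times> (nat \<Rightarrow> nat \<Rightarrow> real)) pmf" where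
  "label_pmf n L \<rho> =
     do {
       x \<leftarrow> pmf_of_set ({..<n} \<rightarrow>\<^sub>E {-1, 1});
       z \<leftarrow> Pi_pmf {1..L} undefined (\<lambda>_. Pi_pmf {..<n} undefined (\<lambda>_. sign_pmf \<rho>));
       return_pmf (x, \<lambda>l i. x i * z l i)
     }"

text \<open>The normal law on the real line; for \<open>\<sigma> = 0\<close> it is the point mass at the mean.\<close>
definition gaussian_measure :: "real \<Rightarrow> real \<Rightarrow> real measure" where
  "gaussian_measure m \<sigma> =
     (if \<sigma> = 0 then return borel m else density lborel (\<lambda>x. ennreal (normal_density m \<sigma> x)))"

text \<open>
  Joint Gaussianity: every linear combination is univariate Gaussian. Degenerate covariances
  are allowed, as is needed below when \<open>\<rho> = 1\<close>.
\<close>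
definition jointly_gaussian :: "'a measure \<Rightarrow> 'i set \<Rightarrow> ('i \<Rightarrow> 'a \<Rightarrow> real) \<Rightarrow> bool" where
  "jointly_gaussian M I X \<longleftrightarrow>
     prob_space M \<and> finite I \<and> (\<forall>i\<in>I. X i \<in> borel_measurable M) \<and>
     (\<forall>c :: 'i \<Rightarrow> real. \<exists>m \<sigma>. \<sigma> \<ge> 0 \<and>
        distr M borel (\<lambda>\<omega>. \<Sum>i\<in>I. c i * X i \<omega>) = gaussian_measure m \<sigma>)"

text \<open>
  \<open>(U, V\<^sub>1, \<dots>, V\<^sub>L)\<close> is encoded as the family on \<open>{0..L}\<close> with \<open>U\<close> at index \<open>0\<close>;
  the value \<open>V 0\<close> is irrelevant.
\<close>
definition limit_gaussians ::
  "'a measure \<Rightarrow> nat \<Rightarrow> real \<Rightarrow> ('a \<Rightarrow> real) \<Rightarrow> (nat \<Rightarrow> 'a \<Rightarrow> real) \<Rightarrow> bool" where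
  "limit_gaussians M L \<rho> U V \<longleftrightarrow>
     jointly_gaussian M {0..L} (V(0 := U)) \<and>
     (\<integral>\<omega>. U \<omega> \<partial>M) = 0 \<and> (\<integral>\<omega>. (U \<omega>)\<^sup>2 \<partial>M) = 1 \<and>
     (\<forall>l\<in>{1..L}. (\<integral>\<omega>. V l \<omega> \<partial>M) = 0 \<and> (\<integral>\<omega>. (V l \<omega>)\<^sup>2 \<partial>M) = 1 \<and>
        (\<integral>\<omega>. U \<omega> * V l \<omega> \<partial>M) = \<rho>\<^sup>2) \<and>
     (\<forall>l\<in>{1..L}. \<forall>l'\<in>{1..L}. l \<noteq> l' \<longrightarrow> (\<integral>\<omega>. V l \<omega> * V l' \<omega> \<partial>M) = \<rho> ^ 4)"

end

theory Submission
  imports Defs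
begin

text \<open>
  Both families are compared through Wick's formula. For centered Gaussians with covariance \<open>K\<close>,
  \<open>E[X\<^sub>j \<Prod>\<^sub>p\<^sub>\<in>\<^sub>B X\<^sub>p] = \<Sum>\<^sub>q\<^sub>\<in>\<^sub>B K j q E[\<Prod>\<^sub>p\<^sub>\<in>\<^sub>B\<^sub>-\<^sub>q X\<^sub>p]\<close>; it is obtained for powers of linear forms from
  the one-dimensional even moments and then polarized. A product of overlaps is expanded over the
  assignments \<open>f\<close> of its factors to the \<open>n\<close> sites. Every term is the square of a moment of signs,
  which depends only on the parities of the fibres, and cancelling a factor against another one at
  the same site shows that the overlaps satisfy Wick's recursion with \<open>\<le>\<close> in place of \<open>=\<close>.
  Induction on the number of factors compares the moments, and the exponential series compares the
  exponentials once the Gaussian side is known to be integrable.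
\<close>

section \<open>Gaussian laws on the line\<close>

text \<open>Joint Gaussianity is given only through the laws of linear combinations, and at
  \<open>\<rho> = 1\<close> the covariance is singular, so a joint density cannot be used: every
  Gaussian fact is drawn from one-dimensional laws. The entries of \<open>limit_cov\<close> are
  squares for the same reason as the terms of the overlap expansion: two independent copies
  contribute the same sign moment. In the recursion one well-chosen partner at the same site
  reproduces a term exactly, and further partners only enlarge the right-hand side; this surplus is
  where equality is lost. The nonnegative entries of \<open>limit_cov\<close> carry the bound
  through the induction. For the exponentials, finiteness on the Gaussian side has to be proved
  first, since the Bochner integral of a non-integrable function is 0. The covariance is a rank-one
  matrix plus a diagonal one; with positive denominators, the condition that the sum of fractions is
  below 1 says exactly that the identity minus the covariance, scaled by the square roots of the
  coefficients on both sides, is positive definite.\<close>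

lemma sets_gaussian_measure [simp, measurable_cong]: "sets (gaussian_measure m \<sigma>) = sets borel"
  and space_gaussian_measure [simp]: "space (gaussian_measure m \<sigma>) = UNIV"
  by (simp_all add: gaussian_measure_def)

lemma integrable_gaussian_power:
  assumes "\<sigma> \<ge> 0"
  shows "integrable (gaussian_measure m \<sigma>) (\<lambda>x. x ^ k)"
proof (cases "\<sigma> = 0")
  case True
  interpret prob_space "return borel m"
    by (rule prob_space_return) simp
  have "AE x in return borel m. norm (x ^ k) \<le> \<bar>m ^ k\<bar>"
    by (subst AE_return) auto
  then show ?thesis
    using True integrable_const_bound[of "\<lambda>x. x ^ k" "\<bar>m ^ k\<bar>"] by (simp add: gaussian_measure_def)
next
  case False
  with assms have "\<sigma> > 0" by simp
  have "integrable lborel (\<lambda>x. \<Sum>i\<le>k. (real (k choose i) * m ^ (k - i)) * (normal_density m \<sigma> x * (x - m) ^ i))"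
    by (intro Bochner_Integration.integrable_sum integrable_mult_right integrable_normal_moment \<open>\<sigma> > 0\<close>)
  moreover have "(\<Sum>i\<le>k. (real (k choose i) * m ^ (k - i)) * (normal_density m \<sigma> x * (x - m) ^ i))
      = normal_density m \<sigma> x * x ^ k" for x
    using binomial_ring[of "x - m" m k] by (simp add: sum_distrib_left mult_ac)
  ultimately show ?thesis
    using \<open>\<sigma> > 0\<close> by (simp add: gaussian_measure_def integrable_density)
qed

lemma integral_gaussian_mean:
  assumes "\<sigma> \<ge> 0"
  shows "(\<integral>x. x \<partial>gaussian_measure m \<sigma>) = m"
proof (cases "\<sigma> = 0")
  case True
  then show ?thesis by (simp add: gaussian_measure_def integral_return)
next
  case False
  with assms have "\<sigma> > 0" by simp
  then show ?thesis
    by (simp add: gaussian_measure_def integral_density integral_normal_moment_nz_1)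
qed

text \<open>The coefficient is (2k-1)!!, the number of perfect pairings of 2k points. Writing the
  variance as \<open>\<sigma>\<^sup>2\<close> allows a quadratic form to be substituted for it
  later.\<close>

lemma integral_gaussian_even_power:
  assumes "\<sigma> \<ge> 0"
  shows "(\<integral>x. x ^ (2 * k) \<partial>gaussian_measure 0 \<sigma>) = fact (2 * k) / (2 ^ k * fact k) * (\<sigma>\<^sup>2) ^ k"
proof (cases "\<sigma> = 0")
  case True
  then show ?thesis
    by (cases k) (simp_all add: gaussian_measure_def integral_return measure_return)
next
  case False
  with assms have "\<sigma> > 0" by simp
  then show ?thesis
    using integral_normal_moment_even[of \<sigma> 0 k]
    by (simp add: gaussian_measure_def integral_density field_simps power_divide)
qed

lemma nn_integral_gaussian_exp:
  assumes "\<sigma> \<ge> 0"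
  shows "(\<integral>\<^sup>+x. ennreal (exp (a * x)) \<partial>gaussian_measure 0 \<sigma>) = ennreal (exp (a\<^sup>2 * \<sigma>\<^sup>2 / 2))"
proof (cases "\<sigma> = 0")
  case True
  then show ?thesis by (simp add: gaussian_measure_def nn_integral_return)
next
  case False
  with assms have pos: "\<sigma> > 0" by simp
  \<comment> \<open>Completing the square: the exponential tilt moves the mean to
    \<open>a * \<sigma>\<^sup>2\<close>.\<close>
  have shift: "normal_density 0 \<sigma> x * exp (a * x) = exp (a\<^sup>2 * \<sigma>\<^sup>2 / 2) * normal_density (a * \<sigma>\<^sup>2) \<sigma> x" for x
  proof -
    have "- (x\<^sup>2 / (2 * \<sigma>\<^sup>2)) + a * x = a\<^sup>2 * \<sigma>\<^sup>2 / 2 + - ((x - a * \<sigma>\<^sup>2)\<^sup>2 / (2 * \<sigma>\<^sup>2))"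
      using pos by (simp add: field_simps power2_eq_square)
    then have "exp (- (x\<^sup>2 / (2 * \<sigma>\<^sup>2))) * exp (a * x)
        = exp (a\<^sup>2 * \<sigma>\<^sup>2 / 2) * exp (- ((x - a * \<sigma>\<^sup>2)\<^sup>2 / (2 * \<sigma>\<^sup>2)))"
      by (metis exp_add)
    then show ?thesis by (simp add: normal_density_def)
  qed
  have "(\<integral>\<^sup>+x. ennreal (exp (a * x)) \<partial>gaussian_measure 0 \<sigma>)
      = (\<integral>\<^sup>+x. ennreal (exp (a\<^sup>2 * \<sigma>\<^sup>2 / 2)) * ennreal (normal_density (a * \<sigma>\<^sup>2) \<sigma> x) \<partial>lborel)"
    using pos by (simp add: gaussian_measure_def nn_integral_density ennreal_mult'[symmetric] shift)
  also have "\<dots> = ennreal (exp (a\<^sup>2 * \<sigma>\<^sup>2 / 2)) * (\<integral>\<^sup>+x. ennreal (normal_density (a * \<sigma>\<^sup>2) \<sigma> x) \<partial>lborel)"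
    by (rule nn_integral_cmult) simp
  also have "(\<integral>\<^sup>+x. ennreal (normal_density (a * \<sigma>\<^sup>2) \<sigma> x) \<partial>lborel) = 1"
    using pos by (subst nn_integral_eq_integral) auto
  finally show ?thesis by simp
qed

lemma prob_space_gaussian_measure:
  assumes "\<sigma> \<ge> 0"
  shows "prob_space (gaussian_measure m \<sigma>)"
  using assms by (auto simp: gaussian_measure_def intro!: prob_space_return prob_space_normal_density)

lemma nn_integral_gaussian_exp_square_finite:
  assumes "\<eta> < 1"
  shows "(\<integral>\<^sup>+x. ennreal (exp (\<eta> * x\<^sup>2 / 2)) \<partial>gaussian_measure 0 1) < \<infinity>"
proof -
  \<comment> \<open>The tilted weight is proportional to a Gaussian density of variance
    \<open>1 / (1 - \<eta>)\<close>; this is where \<open>\<eta> < 1\<close> enters.\<close>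
  define \<tau> where "\<tau> = 1 / sqrt (1 - \<eta>)"
  have pos: "\<tau> > 0" and \<tau>2: "\<tau>\<^sup>2 = 1 / (1 - \<eta>)"
    using assms by (simp_all add: \<tau>_def power_divide)
  have rescale: "normal_density 0 1 x * exp (\<eta> * x\<^sup>2 / 2) = \<tau> * normal_density 0 \<tau> x" for x
  proof -
    have "- (x\<^sup>2 / 2) + \<eta> * x\<^sup>2 / 2 = - (x\<^sup>2 / (2 * \<tau>\<^sup>2))"
      using assms by (simp add: \<tau>2 field_simps)
    then have "exp (- (x\<^sup>2 / 2)) * exp (\<eta> * x\<^sup>2 / 2) = exp (- (x\<^sup>2 / (2 * \<tau>\<^sup>2)))"
      by (metis exp_add)
    then show ?thesis using pos by (simp add: normal_density_def real_sqrt_mult)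
  qed
  have "(\<integral>\<^sup>+x. ennreal (exp (\<eta> * x\<^sup>2 / 2)) \<partial>gaussian_measure 0 1)
      = (\<integral>\<^sup>+x. ennreal \<tau> * ennreal (normal_density 0 \<tau> x) \<partial>lborel)"
    using pos by (simp add: gaussian_measure_def nn_integral_density ennreal_mult'[symmetric] rescale)
  also have "\<dots> = ennreal \<tau> * (\<integral>\<^sup>+x. ennreal (normal_density 0 \<tau> x) \<partial>lborel)"
    by (rule nn_integral_cmult) simp
  also have "(\<integral>\<^sup>+x. ennreal (normal_density 0 \<tau> x) \<partial>lborel) = 1"
    using pos by (subst nn_integral_eq_integral) auto
  finally show ?thesis by simp
qed

section \<open>Integrability of products\<close>

text \<open>Unlike plain integrability, this property is closed under products and powers, so every
  monomial in Gaussian variables is integrable as soon as each marginal is understood.\<close>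

definition all_moments :: "'a measure \<Rightarrow> ('a \<Rightarrow> real) \<Rightarrow> bool" where
  "all_moments M f \<longleftrightarrow> f \<in> borel_measurable M \<and> (\<forall>k. integrable M (\<lambda>\<omega>. f \<omega> ^ k))"

lemma all_moments_integrable: "all_moments M f \<Longrightarrow> integrable M f"
  unfolding all_moments_def by (drule conjunct2) (drule spec[of _ 1], simp)

lemma all_moments_mult:
  assumes "all_moments M f" "all_moments M g"
  shows "all_moments M (\<lambda>\<omega>. f \<omega> * g \<omega>)"
  unfolding all_moments_def
proof (intro conjI allI)
  have [measurable]: "f \<in> borel_measurable M" "g \<in> borel_measurable M"
    using assms by (simp_all add: all_moments_def)
  show "(\<lambda>\<omega>. f \<omega> * g \<omega>) \<in> borel_measurable M" by measurable
  fix k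
  have "integrable M (\<lambda>\<omega>. f \<omega> ^ (2 * k) + g \<omega> ^ (2 * k))"
    using assms by (simp add: all_moments_def)
  then show "integrable M (\<lambda>\<omega>. (f \<omega> * g \<omega>) ^ k)"
  proof (rule Bochner_Integration.integrable_bound)
    have "\<bar>a * b\<bar> \<le> a\<^sup>2 + b\<^sup>2" for a b :: real
      using sum_squares_bound[of "\<bar>a\<bar>" "\<bar>b\<bar>"] mult_nonneg_nonneg[of "\<bar>a\<bar>" "\<bar>b\<bar>"]
      unfolding abs_mult power2_abs by linarith
    then have "\<bar>(f \<omega> * g \<omega>) ^ k\<bar> \<le> f \<omega> ^ (2 * k) + g \<omega> ^ (2 * k)" for \<omega>
      unfolding power_mult_distrib power_even_eq by blast
    then show "AE \<omega> in M. norm ((f \<omega> * g \<omega>) ^ k) \<le> norm (f \<omega> ^ (2 * k) + g \<omega> ^ (2 * k))"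
      by (auto intro: order_trans[OF _ abs_ge_self])
  qed measurable
qed

lemma all_moments_power:
  assumes "all_moments M f"
  shows "all_moments M (\<lambda>\<omega>. f \<omega> ^ k)"
proof -
  have [measurable]: "f \<in> borel_measurable M"
    using assms by (simp add: all_moments_def)
  have "integrable M (\<lambda>\<omega>. (f \<omega> ^ k) ^ j)" for j
    using assms unfolding all_moments_def power_mult[symmetric] by blast
  then show ?thesis by (simp add: all_moments_def)
qed

lemma all_moments_prod:
  assumes "prob_space M" "\<And>i. i \<in> A \<Longrightarrow> all_moments M (f i)"
  shows "all_moments M (\<lambda>\<omega>. \<Prod>i\<in>A. f i \<omega>)"
proof -
  interpret prob_space M by fact
  have const: "all_moments M (\<lambda>_. 1)"
    by (simp add: all_moments_def)
  show ?thesis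
    using assms(2)
  proof (induction A rule: infinite_finite_induct)
    case (insert i A)
    then have "all_moments M (\<lambda>\<omega>. f i \<omega> * (\<Prod>i\<in>A. f i \<omega>))"
      by (intro all_moments_mult) blast+
    with insert.hyps show ?case by simp
  qed (simp_all add: const)
qed

section \<open>Wick's formula\<close>

text \<open>The sum factorizes over the coordinates, and a coordinate in \<open>B\<close>
  contributes -1 + 1.\<close>

lemma sign_sum_zero:
  assumes "finite A" "B \<subseteq> A" "B \<noteq> {}"
  shows "(\<Sum>s\<in>A \<rightarrow>\<^sub>E {-1, 1::real}. \<Prod>p\<in>B. s p) = 0"
proof -
  have "(\<Sum>s\<in>A \<rightarrow>\<^sub>E {-1, 1::real}. \<Prod>p\<in>B. s p)
      = (\<Sum>s\<in>A \<rightarrow>\<^sub>E {-1, 1::real}. \<Prod>p\<in>A. if p \<in> B then s p else 1)"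
    using assms by (intro sum.cong refl) (simp add: prod.If_cases Int_absorb1)
  also have "\<dots> = (\<Prod>p\<in>A. \<Sum>b\<in>{-1, 1::real}. if p \<in> B then b else 1)"
    using assms by (subst prod_sum_PiE) auto
  also have "\<dots> = 0"
  proof -
    obtain p where "p \<in> B" using assms by auto
    then show ?thesis using assms by (intro prod_zero) (auto intro!: bexI[of _ p])
  qed
  finally show ?thesis .
qed

text \<open>Averaging over random signs extracts the squarefree monomial of \<open>B\<close> from
  the power. Expanding one factor of the power toggles one point of \<open>B\<close>; m toggles can
  empty a set of at least m points only if it has exactly m and each is removed once, in one of m!
  orders.\<close>

lemma sign_polarization:
  fixes g :: "'i \<Rightarrow> real"
  assumes A: "finite A" and B: "B \<subseteq> A" "card B \<ge> m"
  shows "(\<Sum>s\<in>A \<rightarrow>\<^sub>E {-1, 1::real}. (\<Prod>p\<in>B. s p) * (\<Sum>p\<in>A. s p * g p) ^ m)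
       = (if card B = m then 2 ^ card A * fact m * (\<Prod>p\<in>B. g p) else 0)"
  using B
proof (induction m arbitrary: B)
  case 0
  have "finite B" using A 0 finite_subset by blast
  show ?case
  proof (cases "B = {}")
    case True
    then show ?thesis using A by (simp add: card_PiE)
  next
    case False
    then show ?thesis using A 0 \<open>finite B\<close> by (simp add: sign_sum_zero)
  qed
next
  case (Suc m)
  have fB: "finite B" using A Suc finite_subset by blast
  let ?S = "A \<rightarrow>\<^sub>E {-1, 1::real}"
  let ?Y = "\<lambda>s. \<Sum>p\<in>A. s p * g p"
  have flip: "(\<Prod>p\<in>B. s p) * s q = (\<Prod>p\<in>(if q \<in> B then B - {q} else insert q B). s p)"
    if "s \<in> ?S" "q \<in> A" for s q
  proof -
    have "s q \<in> {-1, 1}" using that by auto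
    then have "s q * s q = 1" by auto
    then show ?thesis using fB
      by (auto simp: prod.remove[of B q] mult_ac)
  qed
  have "(\<Sum>s\<in>?S. (\<Prod>p\<in>B. s p) * ?Y s ^ Suc m)
      = (\<Sum>s\<in>?S. \<Sum>q\<in>A. g q * (((\<Prod>p\<in>B. s p) * s q) * ?Y s ^ m))"
    by (intro sum.cong refl) (simp add: sum_distrib_left sum_distrib_right mult_ac)
  also have "\<dots> = (\<Sum>q\<in>A. g q * (\<Sum>s\<in>?S. (\<Prod>p\<in>(if q \<in> B then B - {q} else insert q B). s p) * ?Y s ^ m))"
    by (subst sum.swap) (simp add: sum_distrib_left flip)
  also have "\<dots> = (\<Sum>q\<in>A. if q \<in> B \<and> card B = Suc m then 2 ^ card A * fact m * (\<Prod>p\<in>B. g p) else 0)"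
  proof (rule sum.cong[OF refl])
    fix q assume q: "q \<in> A"
    show "g q * (\<Sum>s\<in>?S. (\<Prod>p\<in>(if q \<in> B then B - {q} else insert q B). s p) * ?Y s ^ m)
       = (if q \<in> B \<and> card B = Suc m then 2 ^ card A * fact m * (\<Prod>p\<in>B. g p) else 0)"
    proof (cases "q \<in> B")
      case True
      then show ?thesis
        using Suc.IH[of "B - {q}"] Suc.prems fB
        by (auto simp: prod.remove[of B q] card_Diff_singleton subset_iff)
    next
      \<comment> \<open>Adding q leaves more than m points for the m remaining factors, so the inner
        sum vanishes.\<close>
      case False
      then show ?thesis
        using Suc.IH[of "insert q B"] Suc.prems fB q by auto
    qed
  qed
  also have "\<dots> = (if card B = Suc m then 2 ^ card A * fact (Suc m) * (\<Prod>p\<in>B. g p) else 0)"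
  proof -
    \<comment> \<open>The \<open>Suc m\<close> equal contributions, one for each q in
      \<open>B\<close>, turn \<open>fact m\<close> into \<open>fact (Suc m)\<close>.\<close>
    have "A \<inter> B = B" using Suc.prems by auto
    then show ?thesis using A by (auto simp flip: sum.inter_restrict simp: sum.inter_restrict[symmetric])
  qed
  finally show ?case .
qed

section \<open>Centered Gaussian families\<close>

text \<open>\<open>\<sigma> = 0\<close> is permitted, so \<open>K\<close> may be singular; this
  admits both \<open>\<rho> = 1\<close> and families with repeated variables. Symmetry is assumed
  separately because the laws see only the symmetric part of \<open>K\<close>.\<close>

locale centered_gaussian = prob_space M for M :: "'a measure" +
  fixes I :: "'i set" and X :: "'i \<Rightarrow> 'a \<Rightarrow> real" and K :: "'i \<Rightarrow> 'i \<Rightarrow> real"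
  assumes finite_index: "finite I"
    and measurable_X: "i \<in> I \<Longrightarrow> X i \<in> borel_measurable M"
    and covariance_sym: "K i j = K j i"
    and law: "\<exists>\<sigma>\<ge>0. \<sigma>\<^sup>2 = (\<Sum>i\<in>I. \<Sum>j\<in>I. c i * c j * K i j) \<and>
      distr M borel (\<lambda>\<omega>. \<Sum>i\<in>I. c i * X i \<omega>) = gaussian_measure 0 \<sigma>"
begin

definition lin :: "('i \<Rightarrow> real) \<Rightarrow> 'a \<Rightarrow> real" where
  "lin c \<omega> = (\<Sum>i\<in>I. c i * X i \<omega>)"

definition cov :: "('i \<Rightarrow> real) \<Rightarrow> ('i \<Rightarrow> real) \<Rightarrow> real" where
  "cov c d = (\<Sum>i\<in>I. \<Sum>j\<in>I. c i * d j * K i j)"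

lemma lin_law:
  obtains \<sigma> where "\<sigma> \<ge> 0" "\<sigma>\<^sup>2 = cov c c" "distr M borel (lin c) = gaussian_measure 0 \<sigma>"
  using law[of c] unfolding lin_def[abs_def] cov_def by auto

lemma measurable_lin [measurable]: "lin c \<in> borel_measurable M"
  unfolding lin_def[abs_def] using measurable_X by measurable

lemma all_moments_lin: "all_moments M (lin c)"
proof -
  obtain \<sigma> where \<sigma>: "\<sigma> \<ge> 0" "distr M borel (lin c) = gaussian_measure 0 \<sigma>"
    using lin_law[of c] by metis
  have "integrable M (\<lambda>\<omega>. lin c \<omega> ^ k)" for k
    using integrable_gaussian_power[OF \<sigma>(1), of 0 k]
    by (subst integrable_distr_eq[symmetric, of _ _ borel "\<lambda>x. x ^ k"]) (simp_all add: \<sigma>)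
  then show ?thesis by (simp add: all_moments_def)
qed

lemma expectation_lin_even_power:
  "expectation (\<lambda>\<omega>. lin c \<omega> ^ (2 * k)) = fact (2 * k) / (2 ^ k * fact k) * cov c c ^ k"
proof -
  obtain \<sigma> where \<sigma>: "\<sigma> \<ge> 0" "\<sigma>\<^sup>2 = cov c c" "distr M borel (lin c) = gaussian_measure 0 \<sigma>"
    using lin_law[of c] by metis
  have "expectation (\<lambda>\<omega>. lin c \<omega> ^ (2 * k)) = (\<integral>x. x ^ (2 * k) \<partial>distr M borel (lin c))"
    by (subst integral_distr) simp_all
  then show ?thesis
    by (simp add: \<sigma> integral_gaussian_even_power)
qed

lemma nn_integral_exp_lin: "(\<integral>\<^sup>+\<omega>. ennreal (exp (lin c \<omega>)) \<partial>M) = ennreal (exp (cov c c / 2))"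
proof -
  obtain \<sigma> where \<sigma>: "\<sigma> \<ge> 0" "\<sigma>\<^sup>2 = cov c c" "distr M borel (lin c) = gaussian_measure 0 \<sigma>"
    using lin_law[of c] by metis
  have "(\<integral>\<^sup>+\<omega>. ennreal (exp (lin c \<omega>)) \<partial>M) = (\<integral>\<^sup>+x. ennreal (exp x) \<partial>distr M borel (lin c))"
    by (subst nn_integral_distr) simp_all
  then show ?thesis
    using nn_integral_gaussian_exp[OF \<sigma>(1), of 1] by (simp add: \<sigma>)
qed

lemma lin_add_scale: "lin (\<lambda>i. c i + t * d i) \<omega> = lin c \<omega> + t * lin d \<omega>"
  by (simp add: lin_def sum.distrib sum_distrib_left algebra_simps)

lemma cov_sym: "cov c d = cov d c"
  unfolding cov_def by (subst sum.swap) (simp add: covariance_sym mult_ac)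

lemma cov_add_scale: "cov (\<lambda>i. c i + t * d i) (\<lambda>i. c i + t * d i) = cov c c + 2 * t * cov c d + t\<^sup>2 * cov d d"
proof -
  have "cov (\<lambda>i. c i + t * d i) (\<lambda>i. c i + t * d i) = cov c c + t * cov c d + t * cov d c + t\<^sup>2 * cov d d"
    unfolding cov_def
    by (simp add: sum.distrib sum_distrib_left algebra_simps power2_eq_square)
  then show ?thesis by (simp add: cov_sym)
qed

text \<open>Both sides of the moment formula for \<open>lin c + t lin d\<close> are polynomials in \<open>t\<close>;
  the identity is the comparison of their derivatives at \<open>t = 0\<close>.\<close>

lemma expectation_lin_mult_odd_power:
  "expectation (\<lambda>\<omega>. lin d \<omega> * lin c \<omega> ^ (2 * k + 1))
     = (2 * k + 1) * cov c d * expectation (\<lambda>\<omega>. lin c \<omega> ^ (2 * k))"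
proof -
  \<comment> \<open>With this exponent, one derivative in the direction d leaves
    \<open>lin c\<close> to the power 2k + 1.\<close>
  let ?N = "2 * k + 2"
  define a where "a i = real (?N choose i) * expectation (\<lambda>\<omega>. lin d \<omega> ^ i * lin c \<omega> ^ (?N - i))" for i
  define b :: real where "b = fact ?N / (2 ^ (k + 1) * fact (k + 1))"
  have int: "integrable M (\<lambda>\<omega>. lin d \<omega> ^ i * lin c \<omega> ^ j)" for i j
    by (intro all_moments_integrable all_moments_mult all_moments_power all_moments_lin)
  have "(\<Sum>i\<le>?N. a i * t ^ i) = b * (cov c c + 2 * t * cov c d + t\<^sup>2 * cov d d) ^ (k + 1)" for t
  proof -
    have "expectation (\<lambda>\<omega>. (lin c \<omega> + t * lin d \<omega>) ^ ?N)
        = expectation (\<lambda>\<omega>. \<Sum>i\<le>?N. (real (?N choose i) * t ^ i) * (lin d \<omega> ^ i * lin c \<omega> ^ (?N - i)))"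
      by (intro Bochner_Integration.integral_cong refl)
         (subst add.commute, simp only: binomial_ring power_mult_distrib mult_ac)
    also have "\<dots> = (\<Sum>i\<le>?N. (real (?N choose i) * t ^ i) * expectation (\<lambda>\<omega>. lin d \<omega> ^ i * lin c \<omega> ^ (?N - i)))"
      by (subst Bochner_Integration.integral_sum) (intro integrable_mult_right int, simp only: integral_mult_right_zero)
    also have "\<dots> = (\<Sum>i\<le>?N. a i * t ^ i)"
      by (simp only: a_def mult_ac)
    finally show ?thesis
      using expectation_lin_even_power[of "\<lambda>i. c i + t * d i" "k + 1"]
      by (simp add: lin_add_scale cov_add_scale b_def)
  qed
  then have eq: "(\<lambda>t. \<Sum>i\<le>?N. a i * t ^ i) = (\<lambda>t. b * (cov c c + 2 * t * cov c d + t\<^sup>2 * cov d d) ^ (k + 1))"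
    by (rule ext)
  have deriv_sum: "((\<lambda>t. \<Sum>i\<le>N. a i * t ^ i) has_real_derivative (\<Sum>i\<le>N. a i * (real i * 0 ^ (i - 1)))) (at 0)" for N
    by (auto intro!: derivative_eq_intros sum.cong)
  \<comment> \<open>At t = 0 only the linear coefficient survives differentiation.\<close>
  have sum0: "(\<Sum>i\<le>?N. a i * (real i * 0 ^ (i - 1))) = a 1"
  proof -
    have "(\<Sum>i\<le>?N. a i * (real i * 0 ^ (i - 1))) = (\<Sum>i\<in>{1::nat}. a i * (real i * 0 ^ (i - 1)))"
    proof (rule sum.mono_neutral_right)
      show "\<forall>i\<in>{..?N} - {1}. a i * (real i * 0 ^ (i - 1)) = 0"
      proof
        fix i assume i: "i \<in> {..?N} - {1::nat}"
        show "a i * (real i * 0 ^ (i - 1)) = 0"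
          using i by (cases "i = 0") (auto simp: power_0_left)
      qed
    qed auto
    then show ?thesis by simp
  qed
  have deriv_cov: "((\<lambda>t. b * (cov c c + 2 * t * cov c d + t\<^sup>2 * cov d d) ^ (k + 1)) has_real_derivative
      b * (real (k + 1) * cov c c ^ k * (2 * cov c d))) (at 0)"
  proof -
    have "((\<lambda>t. cov c c + 2 * t * cov c d + t\<^sup>2 * cov d d) has_real_derivative 2 * cov c d) (at 0)"
      by (auto intro!: derivative_eq_intros)
    from DERIV_cmult[OF DERIV_power[OF this, of "k + 1"], of b]
    show ?thesis by (simp add: mult_ac)
  qed
  have a1: "a 1 = b * (real (k + 1) * cov c c ^ k * (2 * cov c d))"
    using DERIV_unique[OF deriv_sum[of ?N, unfolded eq] deriv_cov] sum0 by linarith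
  \<comment> \<open>Here \<open>b\<close> is (2k+1)!!, and (2k+1)!! = (2k+1) (2k-1)!!; the common
    factor \<open>?N\<close> cancels at the end.\<close>
  have b: "b * (real (k + 1) * 2) = real ?N * (2 * k + 1) * (fact (2 * k) / (2 ^ k * fact k))"
    by (simp add: b_def field_simps del: of_nat_Suc)
  have "real ?N * expectation (\<lambda>\<omega>. lin d \<omega> * lin c \<omega> ^ (2 * k + 1)) = a 1"
    by (simp add: a_def)
  also have "\<dots> = (b * (real (k + 1) * 2)) * (cov c c ^ k * cov c d)"
    unfolding a1 by simp
  also have "\<dots> = real ?N * ((2 * k + 1) * cov c d * expectation (\<lambda>\<omega>. lin c \<omega> ^ (2 * k)))"
    unfolding b expectation_lin_even_power by (simp only: mult_ac)
  finally show ?thesis by simp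
qed

lemma lin_single:
  assumes "i \<in> I"
  shows "lin (\<lambda>j. if j = i then 1 else 0) = X i"
  using assms finite_index
  by (auto simp: lin_def if_distrib[of "\<lambda>x. x * _"] cong: if_cong)

lemma all_moments_X: "i \<in> I \<Longrightarrow> all_moments M (X i)"
  using all_moments_lin lin_single by metis

lemma integrable_prod_power: "integrable M (\<lambda>\<omega>. \<Prod>i\<in>I. X i \<omega> ^ k i)"
  by (intro all_moments_integrable all_moments_prod[OF prob_space_axioms] all_moments_power all_moments_X)

text \<open>The identity for a power of one linear form is applied to the signed sum of the
  \<open>X p\<close> over \<open>B\<close>, for all sign vectors; weighting by the product of the
  signs then isolates the squarefree monomials on both sides. Oddness of \<open>card B\<close> makes
  the one-dimensional identity applicable with exponent \<open>card B\<close>.\<close>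

theorem wick:
  assumes j: "j \<in> I" and B: "B \<subseteq> I" and odd: "odd (card B)"
  shows "expectation (\<lambda>\<omega>. X j \<omega> * (\<Prod>i\<in>B. X i \<omega>))
       = (\<Sum>q\<in>B. K j q * expectation (\<lambda>\<omega>. \<Prod>i\<in>B - {q}. X i \<omega>))"
proof -
  obtain k where k: "card B = 2 * k + 1" using odd by (elim oddE)
  define m where "m = card B"
  have fB: "finite B" using B finite_index finite_subset by blast
  let ?S = "B \<rightarrow>\<^sub>E {-1, 1::real}"
  define e where "e = (\<lambda>i. if i = j then 1 else 0::real)"
  \<comment> \<open>Extension by zero is needed because \<open>s\<close> is \<open>undefined\<close>
    outside \<open>B\<close>.\<close>
  define c where "c s i = (if i \<in> B then s i else 0::real)" for s :: "'i \<Rightarrow> real" and i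
  define Y where "Y s \<omega> = (\<Sum>p\<in>B. s p * X p \<omega>)" for s :: "'i \<Rightarrow> real" and \<omega>
  have linc: "lin (c s) = Y s" for s
  proof
    fix \<omega>
    have "lin (c s) \<omega> = (\<Sum>i\<in>I. if i \<in> B then s i * X i \<omega> else 0)"
      by (auto simp: lin_def c_def intro: sum.cong)
    also have "\<dots> = (\<Sum>i\<in>I \<inter> B. s i * X i \<omega>)"
      using finite_index by (simp add: sum.inter_restrict)
    finally show "lin (c s) \<omega> = Y s \<omega>"
      using B by (simp add: Y_def Int_absorb1)
  qed
  have line: "lin e = X j" unfolding e_def by (rule lin_single[OF j])
  have cove: "cov (c s) e = (\<Sum>q\<in>B. s q * K j q)" for s
  proof -
    have "cov (c s) e = (\<Sum>i\<in>I. c s i * K i j)"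
      unfolding cov_def using j finite_index
      by (simp add: e_def if_distrib[of "\<lambda>x. _ * x"] if_distrib[of "\<lambda>x. x * _"] cong: if_cong)
    also have "\<dots> = (\<Sum>i\<in>I. if i \<in> B then s i * K j i else 0)"
      by (auto simp: c_def covariance_sym intro: sum.cong)
    also have "\<dots> = (\<Sum>i\<in>I \<inter> B. s i * K j i)"
      using finite_index by (simp add: sum.inter_restrict)
    finally show ?thesis using B by (simp add: Int_absorb1)
  qed
  have step: "expectation (\<lambda>\<omega>. X j \<omega> * Y s \<omega> ^ m)
      = (\<Sum>q\<in>B. m * K j q * (s q * expectation (\<lambda>\<omega>. Y s \<omega> ^ (m - 1))))" for s
    using expectation_lin_mult_odd_power[of e "c s" k]
    by (simp add: m_def k linc line cove sum_distrib_left sum_distrib_right mult_ac add.commute)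
  have intY: "integrable M (\<lambda>\<omega>. Y s \<omega> ^ i)" for s i
    unfolding linc[symmetric] by (intro all_moments_integrable all_moments_power all_moments_lin)
  have intXY: "integrable M (\<lambda>\<omega>. X j \<omega> * Y s \<omega> ^ i)" for s i
    unfolding linc[symmetric]
    by (intro all_moments_integrable all_moments_mult all_moments_power all_moments_lin all_moments_X j)
  \<comment> \<open>The factor is the polarization constant, so the monomial can be replaced by a
    signed sum of m-th powers.\<close>
  have "2 ^ m * fact m * expectation (\<lambda>\<omega>. X j \<omega> * (\<Prod>i\<in>B. X i \<omega>))
      = expectation (\<lambda>\<omega>. X j \<omega> * (2 ^ card B * fact m * (\<Prod>i\<in>B. X i \<omega>)))"
    by (subst integral_mult_right_zero[symmetric]) (simp add: m_def mult_ac)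
  also have "\<dots> = expectation (\<lambda>\<omega>. X j \<omega> * (\<Sum>s\<in>?S. (\<Prod>p\<in>B. s p) * Y s \<omega> ^ m))"
    using sign_polarization[OF fB order_refl, of m] by (simp add: Y_def m_def)
  also have "\<dots> = expectation (\<lambda>\<omega>. \<Sum>s\<in>?S. (\<Prod>p\<in>B. s p) * (X j \<omega> * Y s \<omega> ^ m))"
    by (simp add: sum_distrib_left mult_ac)
  also have "\<dots> = (\<Sum>s\<in>?S. (\<Prod>p\<in>B. s p) * expectation (\<lambda>\<omega>. X j \<omega> * Y s \<omega> ^ m))"
    by (subst Bochner_Integration.integral_sum) (intro integrable_mult_right intXY, simp only: integral_mult_right_zero)
  \<comment> \<open>The sign s q from the covariance cancels against the product over
    \<open>B\<close>. The remaining \<open>B - {q}\<close> has m - 1 points, matching the exponent,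
    so polarization applies again, now in the other direction.\<close>
  also have "\<dots> = (\<Sum>s\<in>?S. \<Sum>q\<in>B. m * K j q * ((\<Prod>p\<in>B - {q}. s p) * expectation (\<lambda>\<omega>. Y s \<omega> ^ (m - 1))))"
    unfolding step sum_distrib_left
  proof (intro sum.cong refl)
    fix s q assume s: "s \<in> ?S" and q: "q \<in> B"
    have "s q \<in> {-1, 1}" using s q by auto
    then have "s q * s q = 1" by auto
    then show "(\<Prod>p\<in>B. s p) * (m * K j q * (s q * expectation (\<lambda>\<omega>. Y s \<omega> ^ (m - 1))))
        = m * K j q * ((\<Prod>p\<in>B - {q}. s p) * expectation (\<lambda>\<omega>. Y s \<omega> ^ (m - 1)))"
      using q fB by (simp add: prod.remove[of B q] mult_ac)
  qed
  also have "\<dots> = (\<Sum>q\<in>B. m * K j q * (\<Sum>s\<in>?S. (\<Prod>p\<in>B - {q}. s p) * expectation (\<lambda>\<omega>. Y s \<omega> ^ (m - 1))))"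
    by (subst sum.swap) (simp add: sum_distrib_left)
  also have "\<dots> = (\<Sum>q\<in>B. m * K j q * (2 ^ m * fact (m - 1) * expectation (\<lambda>\<omega>. \<Prod>i\<in>B - {q}. X i \<omega>)))"
  proof (intro sum.cong refl arg_cong2[where f = "(*)"])
    fix q assume q: "q \<in> B"
    have card: "card (B - {q}) = m - 1" using q fB by (simp add: m_def)
    have "(\<Sum>s\<in>?S. (\<Prod>p\<in>B - {q}. s p) * expectation (\<lambda>\<omega>. Y s \<omega> ^ (m - 1)))
        = expectation (\<lambda>\<omega>. \<Sum>s\<in>?S. (\<Prod>p\<in>B - {q}. s p) * Y s \<omega> ^ (m - 1))"
      by (subst Bochner_Integration.integral_sum) (intro integrable_mult_right intY, simp only: integral_mult_right_zero)
    also have "\<dots> = expectation (\<lambda>\<omega>. 2 ^ m * fact (m - 1) * (\<Prod>i\<in>B - {q}. X i \<omega>))"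
      using sign_polarization[OF fB, of "B - {q}" "m - 1"] card by (simp add: Y_def m_def)
    finally show "(\<Sum>s\<in>?S. (\<Prod>p\<in>B - {q}. s p) * expectation (\<lambda>\<omega>. Y s \<omega> ^ (m - 1)))
        = 2 ^ m * fact (m - 1) * expectation (\<lambda>\<omega>. \<Prod>i\<in>B - {q}. X i \<omega>)"
      by simp
  qed
  also have "\<dots> = 2 ^ m * fact m * (\<Sum>q\<in>B. K j q * expectation (\<lambda>\<omega>. \<Prod>i\<in>B - {q}. X i \<omega>))"
  proof -
    have "fact m = real m * fact (m - 1)"
      using k by (intro fact_reduce) (simp add: m_def)
    then show ?thesis by (simp add: sum_distrib_left mult_ac)
  qed
  finally show ?thesis by simp
qed

end

text \<open>\<open>wick\<close> treats each index once; indexing by positions lets the same variable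
  occur several times in a product.\<close>

lemma (in centered_gaussian) reindex:
  assumes A: "finite A" "c ` A \<subseteq> I"
  shows "centered_gaussian M A (\<lambda>p. X (c p)) (\<lambda>p q. K (c p) (c q))"
proof unfold_locales
  show "finite A" by fact
  show "X (c i) \<in> borel_measurable M" if "i \<in> A" for i
    using that A by (intro measurable_X) auto
  show "K (c i) (c j) = K (c j) (c i)" for i j by (rule covariance_sym)
  fix d :: "'b \<Rightarrow> real"
  \<comment> \<open>Coefficients of positions carrying the same variable are collected.\<close>
  define d' where "d' i = (\<Sum>p\<in>{p\<in>A. c p = i}. d p)" for i
  have group: "(\<Sum>i\<in>I. d' i * g i) = (\<Sum>p\<in>A. d p * g (c p))" for g
  proof -
    have "(\<Sum>i\<in>I. d' i * g i) = (\<Sum>i\<in>I. \<Sum>p\<in>{p\<in>A. c p = i}. d p * g (c p))"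
      by (simp add: d'_def sum_distrib_right)
    also have "\<dots> = (\<Sum>p\<in>A. d p * g (c p))"
      using A finite_index by (intro sum.group) auto
    finally show ?thesis .
  qed
  have "(\<Sum>i\<in>I. \<Sum>j\<in>I. d' i * d' j * K i j) = (\<Sum>i\<in>I. d' i * (\<Sum>j\<in>I. d' j * K i j))"
    by (simp add: sum_distrib_left mult_ac)
  also have "\<dots> = (\<Sum>p\<in>A. \<Sum>q\<in>A. d p * d q * K (c p) (c q))"
    by (simp only: group) (simp add: sum_distrib_left mult_ac)
  finally show "\<exists>\<sigma>\<ge>0. \<sigma>\<^sup>2 = (\<Sum>i\<in>A. \<Sum>j\<in>A. d i * d j * K (c i) (c j)) \<and>
      distr M borel (\<lambda>\<omega>. \<Sum>i\<in>A. d i * X (c i) \<omega>) = gaussian_measure 0 \<sigma>"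
    using law[of d'] by (simp add: group)
qed

section \<open>Moments of the overlaps\<close>

text \<open>What is left of a product of signs after equal factors cancel in pairs: adding or
  removing a position toggles its image.\<close>

definition odd_fibres :: "('p \<Rightarrow> 'u) \<Rightarrow> 'p set \<Rightarrow> 'u set" where
  "odd_fibres \<phi> P = {u. odd (card {p\<in>P. \<phi> p = u})}"

lemma odd_fibres_empty [simp]: "odd_fibres \<phi> {} = {}"
  by (simp add: odd_fibres_def)

lemma odd_fibres_subset: "odd_fibres \<phi> P \<subseteq> \<phi> ` P"
proof
  fix u assume "u \<in> odd_fibres \<phi> P"
  then have "card {p\<in>P. \<phi> p = u} \<noteq> 0" by (auto simp: odd_fibres_def intro: ccontr)
  then have "{p\<in>P. \<phi> p = u} \<noteq> {}" by (metis card.empty)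
  then show "u \<in> \<phi> ` P" by auto
qed

lemma finite_odd_fibres: "finite P \<Longrightarrow> finite (odd_fibres \<phi> P)"
  by (rule finite_subset[OF odd_fibres_subset finite_imageI])

lemma odd_fibres_cong:
  assumes "\<And>p. p \<in> P \<Longrightarrow> \<phi> p = \<psi> p"
  shows "odd_fibres \<phi> P = odd_fibres \<psi> P"
proof -
  have "{p\<in>P. \<phi> p = u} = {p\<in>P. \<psi> p = u}" for u using assms by auto
  then show ?thesis by (simp add: odd_fibres_def)
qed

lemma odd_fibres_insert:
  assumes "finite P" "p \<notin> P"
  shows "u \<in> odd_fibres \<phi> (insert p P) \<longleftrightarrow> (u \<in> odd_fibres \<phi> P) \<noteq> (u = \<phi> p)"
proof (cases "\<phi> p = u")
  case True
  then have "{q\<in>insert p P. \<phi> q = u} = insert p {q\<in>P. \<phi> q = u}" by auto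
  then show ?thesis using assms True by (simp add: odd_fibres_def)
next
  case False
  then have "{q\<in>insert p P. \<phi> q = u} = {q\<in>P. \<phi> q = u}" by auto
  then show ?thesis using False by (auto simp: odd_fibres_def)
qed

lemma odd_fibres_remove:
  assumes "finite P" "q \<in> P"
  shows "u \<in> odd_fibres \<phi> (P - {q}) \<longleftrightarrow> (u \<in> odd_fibres \<phi> P) \<noteq> (u = \<phi> q)"
proof -
  have "insert q (P - {q}) = P" using assms by auto
  then show ?thesis
    using odd_fibres_insert[of "P - {q}" q u \<phi>] assms by auto
qed

text \<open>The fibre over i is split according to \<open>c\<close>; an odd total needs an odd
  summand.\<close>

lemma odd_fibres_pair:
  assumes "finite P" "i \<in> odd_fibres f P"
  obtains l where "(l, i) \<in> odd_fibres (\<lambda>p. (c p, f p)) P"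
proof -
  have "card {p\<in>P. f p = i} = (\<Sum>l\<in>c ` P. card {p\<in>{p\<in>P. f p = i}. c p = l})"
    using assms(1) sum.group[of "{p\<in>P. f p = i}" "c ` P" c "\<lambda>_. 1::nat"] by (simp add: image_mono)
  moreover have "odd (card {p\<in>P. f p = i})"
    using assms(2) by (simp add: odd_fibres_def)
  ultimately have "\<exists>l\<in>c ` P. odd (card {p\<in>{p\<in>P. f p = i}. c p = l})"
    using dvd_sum[of "c ` P" 2 "\<lambda>l. card {p\<in>{p\<in>P. f p = i}. c p = l}"] by auto
  then obtain l where "odd (card {p\<in>{p\<in>P. f p = i}. c p = l})" by blast
  moreover have "{p\<in>{p\<in>P. f p = i}. c p = l} = {p\<in>P. (c p, f p) = (l, i)}" by auto
  ultimately show thesis using that by (simp add: odd_fibres_def)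
qed

text \<open>The mean of the noise sign at label l. Label 0 stands for the vector x itself, with
  constant noise 1.\<close>

definition corr :: "real \<Rightarrow> nat \<Rightarrow> real" where
  "corr \<rho> l = (if l = 0 then 1 else \<rho>)"

text \<open>At one site, labels j and l correlate by \<open>corr \<rho> j * corr \<rho> l\<close> in
  each copy; the square comes from multiplying the two copies.\<close>

definition limit_cov :: "real \<Rightarrow> nat \<Rightarrow> nat \<Rightarrow> real" where
  "limit_cov \<rho> j l = (if j = l then 1 else (corr \<rho> j * corr \<rho> l)\<^sup>2)"

text \<open>Closed form of the expected product of the entries of label \<open>c p\<close> at site
  \<open>f p\<close>: the uniform sign of a site must occur evenly often, and every noise sign of
  odd exponent contributes its mean. \<open>expectation_label_prod\<close> proves this.\<close>

definition sign_moment :: "real \<Rightarrow> ('p \<Rightarrow> nat) \<Rightarrow> ('p \<Rightarrow> nat) \<Rightarrow> 'p set \<Rightarrow> real" where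
  "sign_moment \<rho> c f P = of_bool (odd_fibres f P = {}) *
     (\<Prod>u\<in>odd_fibres (\<lambda>p. (c p, f p)) P. corr \<rho> (fst u))"

lemma sign_moment_cong:
  assumes "\<And>p. p \<in> P \<Longrightarrow> f p = g p"
  shows "sign_moment \<rho> c f P = sign_moment \<rho> c g P"
proof -
  have "odd_fibres f P = odd_fibres g P"
    "odd_fibres (\<lambda>p. (c p, f p)) P = odd_fibres (\<lambda>p. (c p, g p)) P"
    using assms by (auto intro!: odd_fibres_cong)
  then show ?thesis by (simp add: sign_moment_def)
qed

lemma limit_cov_nonneg: "limit_cov \<rho> j l \<ge> 0"
  by (simp add: limit_cov_def)

text \<open>All summands on the right are nonnegative, so it suffices to find one q at the site of p
  whose summand equals the left side.\<close>

lemma sign_moment_subwick: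
  assumes P: "finite P" "p \<notin> P"
  shows "(sign_moment \<rho> c f (insert p P))\<^sup>2
     \<le> (\<Sum>q\<in>{q\<in>P. f q = f p}. limit_cov \<rho> (c p) (c q) * (sign_moment \<rho> c f (P - {q}))\<^sup>2)"
    (is "_ \<le> ?R")
proof -
  let ?\<phi> = "\<lambda>p. (c p, f p)"
  have dominated: ?thesis
    if "q \<in> P" "f q = f p"
      "(sign_moment \<rho> c f (insert p P))\<^sup>2 = limit_cov \<rho> (c p) (c q) * (sign_moment \<rho> c f (P - {q}))\<^sup>2" for q
    unfolding that(3) using P that(1,2)
    by (intro member_le_sum) (auto simp: limit_cov_nonneg)
  have rows: "odd_fibres f (insert p P) = odd_fibres f (P - {q})" if "q \<in> P" "f q = f p" for q
    using that P by (auto simp: odd_fibres_insert odd_fibres_remove)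
  have R: "?R \<ge> 0" by (intro sum_nonneg mult_nonneg_nonneg) (auto simp: limit_cov_nonneg)
  consider (match) "?\<phi> p \<in> odd_fibres ?\<phi> P"
    | (zero) "odd_fibres f (insert p P) \<noteq> {}"
    | (pair) "?\<phi> p \<notin> odd_fibres ?\<phi> P" "odd_fibres f (insert p P) = {}"
    by blast
  then show ?thesis
  proof cases
    \<comment> \<open>A partner with the same label and site cancels p outright: the parities agree
      and the covariance is 1.\<close>
    case match
    then obtain q where q: "q \<in> P" "c q = c p" "f q = f p"
      using odd_fibres_subset by fastforce
    have "odd_fibres ?\<phi> (insert p P) = odd_fibres ?\<phi> (P - {q})"
      using q P by (auto simp: odd_fibres_insert odd_fibres_remove)
    then show ?thesis
      using q by (intro dominated[of q]) (auto simp: sign_moment_def rows[OF q(1,3)] limit_cov_def)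
  next
    case zero
    then show ?thesis using R by (simp add: sign_moment_def)
  next
    case pair
    \<comment> \<open>The site total is even with p, hence odd without it, so some label has odd
      multiplicity there. It differs from \<open>c p\<close>, whose multiplicity in \<open>P\<close>
      is even.\<close>
    have "f p \<in> odd_fibres f P"
      using odd_fibres_insert[OF P, of "f p" f] pair by auto
    then obtain l where l: "(l, f p) \<in> odd_fibres ?\<phi> P"
      using odd_fibres_pair[OF P(1)] by metis
    then obtain q where q: "q \<in> P" "c q = l" "f q = f p"
      using odd_fibres_subset[of ?\<phi> P] by auto
    have ne: "c p \<noteq> c q" using l q pair by auto
    \<comment> \<open>Compared with \<open>P - {q}\<close>, exactly the pairs of p and q become odd;
      they contribute the two noise means, whose squared product is the covariance.\<close>
    have "odd_fibres ?\<phi> (insert p P) = insert (?\<phi> p) (insert (?\<phi> q) (odd_fibres ?\<phi> (P - {q})))"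
      using q P l pair by (auto simp: odd_fibres_insert odd_fibres_remove)
    moreover have "?\<phi> q \<notin> odd_fibres ?\<phi> (P - {q})" "?\<phi> p \<notin> odd_fibres ?\<phi> (P - {q})"
      using q P l pair ne by (auto simp: odd_fibres_remove)
    ultimately have "sign_moment \<rho> c f (insert p P)
        = corr \<rho> (c p) * corr \<rho> (c q) * sign_moment \<rho> c f (P - {q})"
      using P ne by (simp add: sign_moment_def rows[OF q(1,3)] finite_odd_fibres)
    then show ?thesis
      using q ne by (intro dominated[of q]) (auto simp: limit_cov_def power_mult_distrib)
  qed
qed

text \<open>The expected product of unnormalized overlaps, one site per factor; the square collects
  the equal moments of the two copies (\<open>expectation_overlap_prod\<close>).\<close>

definition overlap_moment :: "nat \<Rightarrow> real \<Rightarrow> ('p \<Rightarrow> nat) \<Rightarrow> 'p set \<Rightarrow> real" where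
  "overlap_moment n \<rho> c P = (\<Sum>f\<in>P \<rightarrow>\<^sub>E {..<n}. (sign_moment \<rho> c f P)\<^sup>2)"

lemma overlap_moment_subwick:
  assumes P: "finite P" "p \<notin> P"
  shows "overlap_moment n \<rho> c (insert p P)
     \<le> n * (\<Sum>q\<in>P. limit_cov \<rho> (c p) (c q) * overlap_moment n \<rho> c (P - {q}))"
proof -
  let ?F = "insert p P \<rightarrow>\<^sub>E {..<n}"
  have fin: "finite ?F" using P by (intro finite_PiE) auto
  \<comment> \<open>An assignment with p and q at one site is that site together with the
    restriction to \<open>P - {q}\<close>; the free choice of site gives the factor n.\<close>
  have count: "(\<Sum>f\<in>{f\<in>?F. f q = f p}. (sign_moment \<rho> c f (P - {q}))\<^sup>2) = n * overlap_moment n \<rho> c (P - {q})"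
    if q: "q \<in> P" for q
  proof -
    have "(\<Sum>f\<in>{f\<in>?F. f q = f p}. (sign_moment \<rho> c f (P - {q}))\<^sup>2)
        = (\<Sum>(a, g)\<in>{..<n} \<times> (P - {q} \<rightarrow>\<^sub>E {..<n}). (sign_moment \<rho> c g (P - {q}))\<^sup>2)"
    proof (rule sum.reindex_bij_witness[where
          i = "\<lambda>(a, g). g(p := a, q := a)" and j = "\<lambda>f. (f p, restrict f (P - {q}))"])
      fix f assume f: "f \<in> {f\<in>?F. f q = f p}"
      then have "f x = undefined" if "x \<notin> insert p P" for x
        using that by (auto simp: PiE_def extensional_def)
      then show "(case (f p, restrict f (P - {q})) of (a, g) \<Rightarrow> g(p := a, q := a)) = f"
        using f P by (auto simp: fun_eq_iff)
      show "(f p, restrict f (P - {q})) \<in> {..<n} \<times> (P - {q} \<rightarrow>\<^sub>E {..<n})"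
        using f by auto
      show "(case (f p, restrict f (P - {q})) of (a, g) \<Rightarrow> (sign_moment \<rho> c g (P - {q}))\<^sup>2)
          = (sign_moment \<rho> c f (P - {q}))\<^sup>2"
        using sign_moment_cong[of "P - {q}" "restrict f (P - {q})" f] by simp
    next
      fix ag assume ag: "ag \<in> {..<n} \<times> (P - {q} \<rightarrow>\<^sub>E {..<n})"
      then obtain a g where [simp]: "ag = (a, g)" and a: "a < n" and g: "g \<in> P - {q} \<rightarrow>\<^sub>E {..<n}" by auto
      have pq: "p \<noteq> q" using P q by auto
      show "(case ag of (a, g) \<Rightarrow> g(p := a, q := a)) \<in> {f\<in>?F. f q = f p}"
        using a g q pq by (auto simp: PiE_def extensional_def Pi_def)
      have "restrict (g(p := a, q := a)) (P - {q}) = g"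
        using g P by (auto simp: fun_eq_iff PiE_def extensional_def restrict_def)
      then show "((case ag of (a, g) \<Rightarrow> g(p := a, q := a)) p,
          restrict (case ag of (a, g) \<Rightarrow> g(p := a, q := a)) (P - {q})) = ag"
        using pq by simp
    qed
    then show ?thesis
      by (simp add: overlap_moment_def sum.cartesian_product[symmetric])
  qed
  have "overlap_moment n \<rho> c (insert p P)
      \<le> (\<Sum>f\<in>?F. \<Sum>q\<in>{q\<in>P. f q = f p}. limit_cov \<rho> (c p) (c q) * (sign_moment \<rho> c f (P - {q}))\<^sup>2)"
    unfolding overlap_moment_def by (intro sum_mono sign_moment_subwick P)
  also have "\<dots> = (\<Sum>q\<in>P. \<Sum>f\<in>{f\<in>?F. f q = f p}. limit_cov \<rho> (c p) (c q) * (sign_moment \<rho> c f (P - {q}))\<^sup>2)"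
    by (rule sum.swap_restrict[OF fin P(1)])
  also have "\<dots> = (\<Sum>q\<in>P. limit_cov \<rho> (c p) (c q) * (n * overlap_moment n \<rho> c (P - {q})))"
    by (intro sum.cong refl) (simp only: sum_distrib_left[symmetric] count)
  finally show ?thesis
    by (simp add: sum_distrib_left mult_ac)
qed

section \<open>Expectations over the label law\<close>

lemma expectation_pair_pmf_mult:
  fixes f :: "'b \<Rightarrow> real" and g :: "'c \<Rightarrow> real"
  assumes "finite (set_pmf p)" "finite (set_pmf q)"
  shows "measure_pmf.expectation (pair_pmf p q) (\<lambda>(a, b). f a * g b)
       = measure_pmf.expectation p f * measure_pmf.expectation q g"
proof -
  have "measure_pmf.expectation (pair_pmf p q) (\<lambda>(a, b). f a * g b)
      = (\<Sum>(a, b)\<in>set_pmf p \<times> set_pmf q. (f a * pmf p a) * (g b * pmf q b))"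
    using assms by (subst integral_measure_pmf_real[where A = "set_pmf p \<times> set_pmf q"])
      (auto simp: pmf_pair case_prod_beta mult_ac intro: sum.cong)
  also have "\<dots> = (\<Sum>a\<in>set_pmf p. f a * pmf p a) * (\<Sum>b\<in>set_pmf q. g b * pmf q b)"
    by (simp add: sum_product sum.cartesian_product)
  also have "\<dots> = measure_pmf.expectation p f * measure_pmf.expectation q g"
    using assms by (simp add: integral_measure_pmf_real[where A = "set_pmf p"] integral_measure_pmf_real[where A = "set_pmf q"])
  finally show ?thesis .
qed

text \<open>Independence of the coordinates; as the factors may change sign, integrability is
  assumed.\<close>

lemma expectation_prod_Pi_pmf_signed:
  fixes f :: "'i \<Rightarrow> 'b \<Rightarrow> real"
  assumes A: "finite A" and int: "\<And>x. x \<in> A \<Longrightarrow> integrable (measure_pmf (p x)) (f x)"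
  shows "measure_pmf.expectation (Pi_pmf A d p) (\<lambda>y. \<Prod>x\<in>A. f x (y x))
       = (\<Prod>x\<in>A. measure_pmf.expectation (p x) (f x))"
proof -
  have comp: "map_pmf (\<lambda>y. y x) (Pi_pmf A d p) = p x" if "x \<in> A" for x
    using that A by (simp add: Pi_pmf_component)
  have "prob_space.indep_vars (measure_pmf (Pi_pmf A d p)) (\<lambda>_. borel) (\<lambda>x y. f x (y x)) A"
    using prob_space.indep_vars_compose2[OF measure_pmf.prob_space_axioms indep_vars_Pi_pmf[OF A], of f "\<lambda>_. borel"] by simp
  moreover have "integrable (measure_pmf (Pi_pmf A d p)) (\<lambda>y. f x (y x))" if "x \<in> A" for x
    using int[OF that] unfolding comp[OF that, symmetric] by simp
  ultimately have "measure_pmf.expectation (Pi_pmf A d p) (\<lambda>y. \<Prod>x\<in>A. f x (y x))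
      = (\<Prod>x\<in>A. measure_pmf.expectation (Pi_pmf A d p) (\<lambda>y. f x (y x)))"
    by (intro prob_space.indep_vars_lebesgue_integral measure_pmf.prob_space_axioms A) auto
  also have "\<dots> = (\<Prod>x\<in>A. measure_pmf.expectation (p x) (f x))"
  proof (intro prod.cong refl)
    fix x assume "x \<in> A"
    show "measure_pmf.expectation (Pi_pmf A d p) (\<lambda>y. f x (y x)) = measure_pmf.expectation (p x) (f x)"
      unfolding comp[OF \<open>x \<in> A\<close>, symmetric] by simp
  qed
  finally show ?thesis .
qed

lemma expectation_uniform_sign_power:
  "measure_pmf.expectation (pmf_of_set {-1, 1::real}) (\<lambda>x. x ^ k) = of_bool (even k)"
  by (subst integral_pmf_of_set) auto

lemma expectation_sign_pmf_power:
  assumes "0 \<le> \<rho>" "\<rho> \<le> 1"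
  shows "measure_pmf.expectation (sign_pmf \<rho>) (\<lambda>x. x ^ k) = (if even k then 1 else \<rho>)"
  using assms by (simp add: sign_pmf_def field_simps)

lemma prod_fibres:
  fixes g :: "'u \<Rightarrow> real"
  assumes "finite P" "finite U" "\<phi> ` P \<subseteq> U"
  shows "(\<Prod>p\<in>P. g (\<phi> p)) = (\<Prod>u\<in>U. g u ^ card {p\<in>P. \<phi> p = u})"
proof -
  have "(\<Prod>p\<in>P. g (\<phi> p)) = (\<Prod>u\<in>U. \<Prod>p\<in>{p\<in>P. \<phi> p = u}. g (\<phi> p))"
    using prod.group[OF assms, of "\<lambda>p. g (\<phi> p)"] by simp
  also have "\<dots> = (\<Prod>u\<in>U. g u ^ card {p\<in>P. \<phi> p = u})"
  proof (intro prod.cong refl)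
    fix u
    have "(\<Prod>p\<in>{p\<in>P. \<phi> p = u}. g (\<phi> p)) = (\<Prod>p\<in>{p\<in>P. \<phi> p = u}. g u)"
      by (intro prod.cong) auto
    then show "(\<Prod>p\<in>{p\<in>P. \<phi> p = u}. g (\<phi> p)) = g u ^ card {p\<in>P. \<phi> p = u}" by simp
  qed
  finally show ?thesis .
qed

lemma prod_odd_fibres:
  fixes g :: "'u \<Rightarrow> real"
  assumes "finite P" "finite U" "\<phi> ` P \<subseteq> U"
  shows "(\<Prod>u\<in>U. if even (card {p\<in>P. \<phi> p = u}) then 1 else g u) = (\<Prod>u\<in>odd_fibres \<phi> P. g u)"
proof -
  have "odd_fibres \<phi> P \<subseteq> U" by (rule order_trans[OF odd_fibres_subset assms(3)])
  moreover have "(if even (card {p\<in>P. \<phi> p = u}) then 1 else g u) = (if u \<in> odd_fibres \<phi> P then g u else 1)" for u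
    by (simp add: odd_fibres_def)
  ultimately show ?thesis
    using assms by (simp add: Int_absorb1 flip: prod.inter_restrict)
qed

text \<open>Places x at index 0, in parallel with \<open>V(0 := U)\<close> on the Gaussian
  side.\<close>

definition label :: "(nat \<Rightarrow> real) \<times> (nat \<Rightarrow> nat \<Rightarrow> real) \<Rightarrow> nat \<Rightarrow> nat \<Rightarrow> real" where
  "label w l = (if l = 0 then fst w else snd w l)"

definition noise_pmf :: "nat \<Rightarrow> nat \<Rightarrow> real \<Rightarrow> (nat \<Rightarrow> nat \<Rightarrow> real) pmf" where
  "noise_pmf n L \<rho> = Pi_pmf {1..L} undefined (\<lambda>_. Pi_pmf {..<n} undefined (\<lambda>_. sign_pmf \<rho>))"

text \<open>The uniform law on sign vectors is a product of uniform signs, which exposes all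
  independent coordinates at once.\<close>

lemma label_pmf_eq:
  "label_pmf n L \<rho> = map_pmf (\<lambda>(x, z). (x, \<lambda>l i. x i * z l i))
     (pair_pmf (Pi_pmf {..<n} undefined (\<lambda>_. pmf_of_set {-1, 1})) (noise_pmf n L \<rho>))"
proof -
  have "{..<n} \<rightarrow>\<^sub>E {-1, 1::real} = PiE_dflt {..<n} undefined (\<lambda>_. {-1, 1})"
    by (auto simp: PiE_dflt_def PiE_def Pi_def extensional_def)
  then have "pmf_of_set ({..<n} \<rightarrow>\<^sub>E {-1, 1::real}) = Pi_pmf {..<n} undefined (\<lambda>_. pmf_of_set {-1, 1})"
    by (simp add: Pi_pmf_of_set)
  then show ?thesis
    by (simp add: label_pmf_def noise_pmf_def pair_pmf_def map_bind_pmf)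
qed

lemma finite_set_sign_pmf: "finite (set_pmf (sign_pmf \<rho>))"
  by (simp add: sign_pmf_def)

lemma finite_set_Pi_pmf:
  assumes "finite A" "\<And>x. x \<in> A \<Longrightarrow> finite (set_pmf (p x))"
  shows "finite (set_pmf (Pi_pmf A d p))"
  by (rule finite_subset[OF set_Pi_pmf_subset'[OF assms(1)]]) (auto intro!: finite_PiE_dflt assms)

lemma finite_set_noise_pmf: "finite (set_pmf (noise_pmf n L \<rho>))"
  unfolding noise_pmf_def by (intro finite_set_Pi_pmf finite_set_sign_pmf) auto

lemma finite_set_label_pmf: "finite (set_pmf (label_pmf n L \<rho>))"
  unfolding label_pmf_eq
  by (auto intro!: finite_imageI finite_cartesian_product finite_set_Pi_pmf finite_set_noise_pmf)

lemma expectation_noise: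
  assumes "0 \<le> \<rho>" "\<rho> \<le> 1"
  shows "measure_pmf.expectation (noise_pmf n L \<rho>) (\<lambda>z. \<Prod>l=1..L. \<Prod>i<n. z l i ^ k l i)
     = (\<Prod>l=1..L. \<Prod>i<n. if even (k l i) then 1 else \<rho>)"
proof -
  have "measure_pmf.expectation (noise_pmf n L \<rho>) (\<lambda>z. \<Prod>l=1..L. \<Prod>i<n. z l i ^ k l i)
     = (\<Prod>l=1..L. measure_pmf.expectation (Pi_pmf {..<n} undefined (\<lambda>_. sign_pmf \<rho>)) (\<lambda>y. \<Prod>i<n. y i ^ k l i))"
    unfolding noise_pmf_def
    by (intro expectation_prod_Pi_pmf_signed integrable_measure_pmf_finite finite_set_Pi_pmf finite_set_sign_pmf) auto
  also have "\<dots> = (\<Prod>l=1..L. \<Prod>i<n. measure_pmf.expectation (sign_pmf \<rho>) (\<lambda>y. y ^ k l i))"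
    by (intro prod.cong refl expectation_prod_Pi_pmf_signed integrable_measure_pmf_finite finite_set_sign_pmf) auto
  finally show ?thesis using assms by (simp add: expectation_sign_pmf_power)
qed

lemma expectation_uniform_signs:
  fixes n :: nat
  shows
  "measure_pmf.expectation (Pi_pmf {..<n} undefined (\<lambda>_. pmf_of_set {-1, 1::real})) (\<lambda>x. \<Prod>i<n. x i ^ k i)
     = (\<Prod>i<n. of_bool (even (k i)))"
  by (subst expectation_prod_Pi_pmf_signed[where f = "\<lambda>i x. x ^ k i"])
    (simp_all add: expectation_uniform_sign_power integrable_measure_pmf_finite)

text \<open>Each entry is a uniform sign times a noise sign. Uniform signs are grouped by site and
  noise signs by label and site; independence then reduces everything to parities of
  exponents.\<close>

lemma expectation_label_prod:
  assumes \<rho>: "0 \<le> \<rho>" "\<rho> \<le> 1" and P: "finite P" "c ` P \<subseteq> {0..L}" "f ` P \<subseteq> {..<n}"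
  shows "measure_pmf.expectation (label_pmf n L \<rho>) (\<lambda>w. \<Prod>p\<in>P. label w (c p) (f p)) = sign_moment \<rho> c f P"
proof -
  let ?\<phi> = "\<lambda>p. (c p, f p)"
  let ?N = "\<lambda>l i. card {p\<in>P. c p = l \<and> f p = i}"
  have split: "(\<Prod>p\<in>P. label (x, \<lambda>l i. x i * z l i) (c p) (f p))
      = (\<Prod>i<n. x i ^ card {p\<in>P. f p = i}) * (\<Prod>l=1..L. \<Prod>i<n. z l i ^ ?N l i)" for x z
  proof -
    \<comment> \<open>The noise of label 0 is 1, so labels 0 to L can be treated alike.\<close>
    define g where "g u = (if fst u = 0 then 1 else z (fst u) (snd u))" for u :: "nat \<times> nat"
    have "(\<Prod>p\<in>P. label (x, \<lambda>l i. x i * z l i) (c p) (f p)) = (\<Prod>p\<in>P. x (f p)) * (\<Prod>p\<in>P. g (?\<phi> p))"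
      by (auto simp: label_def g_def simp flip: prod.distrib intro: prod.cong)
    also have "(\<Prod>p\<in>P. x (f p)) = (\<Prod>i<n. x i ^ card {p\<in>P. f p = i})"
      using P by (intro prod_fibres) auto
    also have "(\<Prod>p\<in>P. g (?\<phi> p)) = (\<Prod>u\<in>{0..L} \<times> {..<n}. g u ^ card {p\<in>P. ?\<phi> p = u})"
      using P by (intro prod_fibres) auto
    also have "\<dots> = (\<Prod>l\<in>{0..L}. \<Prod>i<n. g (l, i) ^ ?N l i)"
      by (subst prod.cartesian_product) (auto intro: prod.cong)
    also have "\<dots> = (\<Prod>l=1..L. \<Prod>i<n. z l i ^ ?N l i)"
      by (simp add: prod.atLeast_Suc_atMost g_def)
    finally show ?thesis .
  qed
  have "measure_pmf.expectation (label_pmf n L \<rho>) (\<lambda>w. \<Prod>p\<in>P. label w (c p) (f p))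
     = measure_pmf.expectation (pair_pmf (Pi_pmf {..<n} undefined (\<lambda>_. pmf_of_set {-1, 1})) (noise_pmf n L \<rho>))
         (\<lambda>(x, z). (\<Prod>i<n. x i ^ card {p\<in>P. f p = i}) * (\<Prod>l=1..L. \<Prod>i<n. z l i ^ ?N l i))"
    unfolding label_pmf_eq integral_map_pmf by (simp add: case_prod_beta' split)
  also have "\<dots> = (\<Prod>i<n. of_bool (even (card {p\<in>P. f p = i}))) * (\<Prod>l=1..L. \<Prod>i<n. if even (?N l i) then 1 else \<rho>)"
    using \<rho> by (subst expectation_pair_pmf_mult)
      (simp_all only: finite_set_Pi_pmf finite_set_noise_pmf finite_lessThan set_pmf_of_set finite.intros
        insert_not_empty not_False_eq_True expectation_uniform_signs expectation_noise)
  also have "(\<Prod>i<n. of_bool (even (card {p\<in>P. f p = i})) :: real) = of_bool (odd_fibres f P = {})"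
  proof -
    have "(\<Prod>i<n. of_bool (even (card {p\<in>P. f p = i})) :: real)
        = (\<Prod>i<n. if even (card {p\<in>P. f p = i}) then 1 else 0)"
      by (intro prod.cong) auto
    \<comment> \<open>A product of zeros is 1 over the empty set and 0 otherwise, hence the
      indicator.\<close>
    also have "\<dots> = (\<Prod>i\<in>odd_fibres f P. 0)"
      using P by (intro prod_odd_fibres) auto
    finally show ?thesis using finite_odd_fibres[OF P(1), of f] by (simp add: card_gt_0_iff power_0_left)
  qed
  also have "(\<Prod>l=1..L. \<Prod>i<n. if even (?N l i) then 1 else \<rho>) = (\<Prod>u\<in>odd_fibres ?\<phi> P. corr \<rho> (fst u))"
  proof -
    have "(\<Prod>l=1..L. \<Prod>i<n. if even (?N l i) then 1 else \<rho>)
        = (\<Prod>l\<in>{0..L}. \<Prod>i<n. if even (?N l i) then 1 else corr \<rho> l)"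
      by (subst prod.atLeast_Suc_atMost) (simp_all add: corr_def cong: if_cong)
    also have "\<dots> = (\<Prod>u\<in>{0..L} \<times> {..<n}. if even (card {p\<in>P. ?\<phi> p = u}) then 1 else corr \<rho> (fst u))"
      by (subst prod.cartesian_product) (auto intro: prod.cong)
    also have "\<dots> = (\<Prod>u\<in>odd_fibres ?\<phi> P. corr \<rho> (fst u))"
      using P by (intro prod_odd_fibres) auto
    finally show ?thesis .
  qed
  finally show ?thesis by (simp add: sign_moment_def)
qed

definition overlap :: "nat \<Rightarrow> nat \<Rightarrow> ((nat \<Rightarrow> real) \<times> (nat \<Rightarrow> nat \<Rightarrow> real)) \<times> ((nat \<Rightarrow> real) \<times> (nat \<Rightarrow> nat \<Rightarrow> real)) \<Rightarrow> real" where
  "overlap n l \<omega> = inner_prod n (label (fst \<omega>) l) (label (snd \<omega>) l)"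

lemma expectation_overlap_prod:
  assumes \<rho>: "0 \<le> \<rho>" "\<rho> \<le> 1" and P: "finite P" "c ` P \<subseteq> {0..L}"
  shows "measure_pmf.expectation (pair_pmf (label_pmf n L \<rho>) (label_pmf n L \<rho>)) (\<lambda>\<omega>. \<Prod>p\<in>P. overlap n (c p) \<omega>)
     = overlap_moment n \<rho> c P"
proof -
  let ?E = "measure_pmf.expectation (pair_pmf (label_pmf n L \<rho>) (label_pmf n L \<rho>))"
  have "?E (\<lambda>\<omega>. \<Prod>p\<in>P. overlap n (c p) \<omega>)
      = ?E (\<lambda>\<omega>. \<Sum>f\<in>P \<rightarrow>\<^sub>E {..<n}. (\<lambda>(w, w'). (\<Prod>p\<in>P. label w (c p) (f p)) * (\<Prod>p\<in>P. label w' (c p) (f p))) \<omega>)"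
    using P by (simp add: overlap_def inner_prod_def prod_sum_PiE prod.distrib case_prod_beta)
  also have "\<dots> = (\<Sum>f\<in>P \<rightarrow>\<^sub>E {..<n}. ?E (\<lambda>(w, w'). (\<Prod>p\<in>P. label w (c p) (f p)) * (\<Prod>p\<in>P. label w' (c p) (f p))))"
    by (intro Bochner_Integration.integral_sum integrable_measure_pmf_finite) (simp add: finite_set_label_pmf)
  also have "\<dots> = (\<Sum>f\<in>P \<rightarrow>\<^sub>E {..<n}. (sign_moment \<rho> c f P)\<^sup>2)"
  proof (intro sum.cong refl)
    fix f assume f: "f \<in> P \<rightarrow>\<^sub>E {..<n}"
    then have "f ` P \<subseteq> {..<n}" by auto
    then show "?E (\<lambda>(w, w'). (\<Prod>p\<in>P. label w (c p) (f p)) * (\<Prod>p\<in>P. label w' (c p) (f p))) = (sign_moment \<rho> c f P)\<^sup>2"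
      using \<rho> P by (subst expectation_pair_pmf_mult) (simp_all add: finite_set_label_pmf expectation_label_prod power2_eq_square)
  qed
  finally show ?thesis by (simp add: overlap_moment_def)
qed

section \<open>Comparison with the Gaussian limit\<close>

text \<open>Each step removes two positions and costs one factor n, which accounts for the exponent
  \<open>card P div 2\<close>. Covariances are nonnegative, so the induction hypothesis may be
  inserted in the sum.\<close>

lemma overlap_moment_le_gaussian:
  assumes "centered_gaussian M {0..L} X (limit_cov \<rho>)"
    and "finite P" "c ` P \<subseteq> {0..L}" "even (card P)"
  shows "overlap_moment n \<rho> c P \<le> n ^ (card P div 2) * (\<integral>\<omega>. (\<Prod>p\<in>P. X (c p) \<omega>) \<partial>M)"
  using assms(2-4)
proof (induction "card P" arbitrary: P rule: less_induct)
  case less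
  interpret centered_gaussian M "{0..L}" X "limit_cov \<rho>" by fact
  show ?case
  proof (cases "P = {}")
    case True
    then show ?thesis by (simp add: overlap_moment_def sign_moment_def prob_space)
  next
    case False
    then obtain p where p: "p \<in> P" by auto
    define Q where "Q = P - {p}"
    have P: "P = insert p Q" "p \<notin> Q" "finite Q" using p less.prems by (auto simp: Q_def)
    have cardP: "card P = Suc (card Q)" using P by simp
    interpret positions: centered_gaussian M P "\<lambda>p. X (c p)" "\<lambda>p q. limit_cov \<rho> (c p) (c q)"
      by (rule reindex[OF less.prems(1,2)])
    have IH: "overlap_moment n \<rho> c (Q - {q}) \<le> n ^ (card P div 2 - 1) * (\<integral>\<omega>. (\<Prod>p\<in>Q - {q}. X (c p) \<omega>) \<partial>M)"
      if q: "q \<in> Q" for q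
    proof -
      have "card (Q - {q}) = card P - 2" using P q by simp
      moreover have "even (card P - 2)" "(card P - 2) div 2 = card P div 2 - 1"
        using less.prems(3) by auto
      moreover have "card P > 0" using cardP by simp
      moreover have "c ` (Q - {q}) \<subseteq> {0..L}" "finite (Q - {q})"
        using less.prems P by auto
      ultimately show ?thesis
        using less.hyps[of "Q - {q}"] by simp
    qed
    have pos: "card P div 2 > 0" using cardP less.prems(3) by (cases "card Q") auto
    have "overlap_moment n \<rho> c P \<le> n * (\<Sum>q\<in>Q. limit_cov \<rho> (c p) (c q) * overlap_moment n \<rho> c (Q - {q}))"
      unfolding P(1) by (rule overlap_moment_subwick[OF P(3,2)])
    also have "\<dots> \<le> n * (\<Sum>q\<in>Q. limit_cov \<rho> (c p) (c q) *
        (n ^ (card P div 2 - 1) * (\<integral>\<omega>. (\<Prod>p\<in>Q - {q}. X (c p) \<omega>) \<partial>M)))"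
      by (intro mult_left_mono sum_mono IH) (auto simp: limit_cov_nonneg)
    also have "\<dots> = n ^ (card P div 2) * (\<Sum>q\<in>Q. limit_cov \<rho> (c p) (c q) * (\<integral>\<omega>. (\<Prod>p\<in>Q - {q}. X (c p) \<omega>) \<partial>M))"
    proof -
      have "real n ^ (card P div 2) = n * n ^ (card P div 2 - 1)"
        using power_minus_mult[OF pos, of "real n"] by (simp add: mult.commute)
      then show ?thesis by (simp add: sum_distrib_left mult_ac)
    qed
    \<comment> \<open>Wick's formula, read from right to left.\<close>
    also have "(\<Sum>q\<in>Q. limit_cov \<rho> (c p) (c q) * (\<integral>\<omega>. (\<Prod>p\<in>Q - {q}. X (c p) \<omega>) \<partial>M))
        = (\<integral>\<omega>. X (c p) \<omega> * (\<Prod>p\<in>Q. X (c p) \<omega>) \<partial>M)"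
      using less.prems(3) cardP by (subst positions.wick) (auto simp: P)
    finally show ?thesis using P by simp
  qed
qed

lemma expectation_normalized_overlap_le:
  assumes G: "centered_gaussian M {0..L} X (limit_cov \<rho>)" and \<rho>: "0 \<le> \<rho>" "\<rho> \<le> 1" and n: "n \<ge> 1"
    and P: "finite P" "c ` P \<subseteq> {0..L}" "even (card P)"
  shows "measure_pmf.expectation (pair_pmf (label_pmf n L \<rho>) (label_pmf n L \<rho>))
      (\<lambda>\<omega>. \<Prod>p\<in>P. overlap n (c p) \<omega> / sqrt n) \<le> (\<integral>\<omega>. (\<Prod>p\<in>P. X (c p) \<omega>) \<partial>M)"
proof -
  have "sqrt n ^ card P = n ^ (card P div 2)"
    using P(3) by (auto elim!: evenE simp: power_mult)
  then have "measure_pmf.expectation (pair_pmf (label_pmf n L \<rho>) (label_pmf n L \<rho>))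
      (\<lambda>\<omega>. \<Prod>p\<in>P. overlap n (c p) \<omega> / sqrt n) = overlap_moment n \<rho> c P / n ^ (card P div 2)"
    using expectation_overlap_prod[OF \<rho> P(1,2), of n] by (simp add: prod_dividef)
  also have "\<dots> \<le> (\<integral>\<omega>. (\<Prod>p\<in>P. X (c p) \<omega>) \<partial>M)"
    using overlap_moment_le_gaussian[OF G P, of n] n by (simp add: divide_le_eq mult.commute)
  finally show ?thesis .
qed

lemma expectation_overlap_powers_le:
  assumes G: "centered_gaussian M {0..L} X (limit_cov \<rho>)" and \<rho>: "0 \<le> \<rho>" "\<rho> \<le> 1" and n: "n \<ge> 1"
  shows "measure_pmf.expectation (pair_pmf (label_pmf n L \<rho>) (label_pmf n L \<rho>))
      (\<lambda>\<omega>. \<Prod>l\<in>{0..L}. (overlap n l \<omega> / sqrt n) ^ (2 * a l)) \<le> (\<integral>\<omega>. (\<Prod>l\<in>{0..L}. X l \<omega> ^ (2 * a l)) \<partial>M)"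
proof -
  \<comment> \<open>Label l is given \<open>2 * a l\<close> positions, so that powers become
    products over positions.\<close>
  let ?P = "SIGMA l:{0..L}. {..<2 * a l}"
  have "even (card ?P)"
    by (simp add: card_SigmaI flip: sum_distrib_left)
  then have "measure_pmf.expectation (pair_pmf (label_pmf n L \<rho>) (label_pmf n L \<rho>))
      (\<lambda>\<omega>. \<Prod>p\<in>?P. overlap n (fst p) \<omega> / sqrt n) \<le> (\<integral>\<omega>. (\<Prod>p\<in>?P. X (fst p) \<omega>) \<partial>M)"
    by (intro expectation_normalized_overlap_le[OF G \<rho> n]) auto
  moreover have "(\<Prod>p\<in>?P. g (fst p)) = (\<Prod>l\<in>{0..L}. g l ^ (2 * a l))" for g :: "nat \<Rightarrow> real"
    using prod.Sigma[of "{0..L}" "\<lambda>l. {..<2 * a l}" "\<lambda>l _. g l"] by (simp add: case_prod_beta')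
  note this[of "\<lambda>l. overlap n l _ / sqrt n"] this[of "\<lambda>l. X l _"]
  ultimately show ?thesis by simp
qed

section \<open>From moments to exponentials\<close>

text \<open>The factor \<open>UNIV :: bool set\<close> doubles every position, turning squares into
  a product over an even number of positions, the form in which moments are compared.\<close>

lemma quadratic_power_expand:
  fixes b g :: "'i \<Rightarrow> real"
  assumes "finite I"
  shows "(\<Sum>i\<in>I. b i * (g i)\<^sup>2) ^ k
     = (\<Sum>c\<in>{..<k} \<rightarrow>\<^sub>E I. (\<Prod>p<k. b (c p)) * (\<Prod>u\<in>{..<k} \<times> (UNIV :: bool set). g (c (fst u))))"
proof -
  have "(\<Sum>i\<in>I. b i * (g i)\<^sup>2) ^ k = (\<Prod>p<k. \<Sum>i\<in>I. b i * (g i)\<^sup>2)" by simp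
  also have "\<dots> = (\<Sum>c\<in>{..<k} \<rightarrow>\<^sub>E I. \<Prod>p<k. b (c p) * (g (c p))\<^sup>2)"
    using assms by (intro prod_sum_PiE) auto
  also have "\<dots> = (\<Sum>c\<in>{..<k} \<rightarrow>\<^sub>E I. (\<Prod>p<k. b (c p)) * (\<Prod>u\<in>{..<k} \<times> (UNIV :: bool set). g (c (fst u))))"
  proof -
    have "(\<Prod>u\<in>{..<k} \<times> (UNIV :: bool set). h (fst u)) = (\<Prod>p<k. (h p)\<^sup>2)" for h :: "nat \<Rightarrow> real"
      using prod.cartesian_product[of "\<lambda>p _. h p" "UNIV :: bool set" "{..<k}"]
      by (simp add: case_prod_beta')
    from this[of "\<lambda>p. g (_ p)"] show ?thesis by (simp add: prod.distrib)
  qed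
  finally show ?thesis .
qed

lemma expectation_overlap_quadratic_power_le:
  assumes G: "centered_gaussian M {0..L} X (limit_cov \<rho>)" and \<rho>: "0 \<le> \<rho>" "\<rho> \<le> 1" and n: "n \<ge> 1"
    and b: "\<And>l. l \<in> {0..L} \<Longrightarrow> b l \<ge> 0"
  shows "measure_pmf.expectation (pair_pmf (label_pmf n L \<rho>) (label_pmf n L \<rho>))
      (\<lambda>\<omega>. (\<Sum>l\<in>{0..L}. b l * (overlap n l \<omega> / sqrt n)\<^sup>2) ^ k) \<le> (\<integral>\<omega>. (\<Sum>l\<in>{0..L}. b l * (X l \<omega>)\<^sup>2) ^ k \<partial>M)"
    and "integrable M (\<lambda>\<omega>. (\<Sum>l\<in>{0..L}. b l * (X l \<omega>)\<^sup>2) ^ k)"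
proof -
  interpret centered_gaussian M "{0..L}" X "limit_cov \<rho>" by fact
  let ?E = "measure_pmf.expectation (pair_pmf (label_pmf n L \<rho>) (label_pmf n L \<rho>))"
  let ?C = "{..<k} \<rightarrow>\<^sub>E {0..L}"
  let ?P = "{..<k} \<times> (UNIV :: bool set)"
  have int: "integrable M (\<lambda>\<omega>. \<Prod>u\<in>?P. X (c (fst u)) \<omega>)" if "c \<in> ?C" for c
    by (intro all_moments_integrable all_moments_prod[OF prob_space_axioms] all_moments_X PiE_mem[OF that]) auto
  show "integrable M (\<lambda>\<omega>. (\<Sum>l\<in>{0..L}. b l * (X l \<omega>)\<^sup>2) ^ k)"
    unfolding quadratic_power_expand[OF finite_atLeastAtMost]
    by (intro Bochner_Integration.integrable_sum integrable_mult_right int)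
  have "?E (\<lambda>\<omega>. (\<Sum>l\<in>{0..L}. b l * (overlap n l \<omega> / sqrt n)\<^sup>2) ^ k)
      = (\<Sum>c\<in>?C. (\<Prod>p<k. b (c p)) * ?E (\<lambda>\<omega>. \<Prod>u\<in>?P. overlap n (c (fst u)) \<omega> / sqrt n))"
    unfolding quadratic_power_expand[OF finite_atLeastAtMost]
    by (subst Bochner_Integration.integral_sum)
      (simp_all only: integral_mult_right_zero integrable_measure_pmf_finite set_pair_pmf finite_cartesian_product finite_set_label_pmf)
  also have "\<dots> \<le> (\<Sum>c\<in>?C. (\<Prod>p<k. b (c p)) * (\<integral>\<omega>. (\<Prod>u\<in>?P. X (c (fst u)) \<omega>) \<partial>M))"
  proof (intro sum_mono mult_left_mono)
    fix c assume c: "c \<in> ?C"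
    show "?E (\<lambda>\<omega>. \<Prod>u\<in>?P. overlap n (c (fst u)) \<omega> / sqrt n) \<le> (\<integral>\<omega>. (\<Prod>u\<in>?P. X (c (fst u)) \<omega>) \<partial>M)"
    proof (rule expectation_normalized_overlap_le[OF G \<rho> n])
      show "(\<lambda>u. c (fst u)) ` ?P \<subseteq> {0..L}" using PiE_mem[OF c] by fastforce
    qed (simp_all add: card_cartesian_product)
    show "0 \<le> (\<Prod>p<k. b (c p))"
      by (intro prod_nonneg b ballI PiE_mem[OF c])
  qed
  also have "\<dots> = (\<integral>\<omega>. (\<Sum>l\<in>{0..L}. b l * (X l \<omega>)\<^sup>2) ^ k \<partial>M)"
    unfolding quadratic_power_expand[OF finite_atLeastAtMost]
    by (subst Bochner_Integration.integral_sum) (simp_all add: int)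
  finally show "?E (\<lambda>\<omega>. (\<Sum>l\<in>{0..L}. b l * (overlap n l \<omega> / sqrt n)\<^sup>2) ^ k)
      \<le> (\<integral>\<omega>. (\<Sum>l\<in>{0..L}. b l * (X l \<omega>)\<^sup>2) ^ k \<partial>M)" .
qed

lemma exp_partial_sum_le:
  fixes x :: real
  assumes "x \<ge> 0"
  shows "(\<Sum>k<N. x ^ k / fact k) \<le> exp x"
  using sum_le_suminf[OF summable_exp_generic[of x], of "{..<N}"] assms
  by (simp add: exp_def divide_inverse mult.commute)

text \<open>Partial sums of the exponential series are compared term by term. The Gaussian ones stay
  below the full exponential; the overlap ones converge because the label law has finite
  support.\<close>

lemma expectation_exp_overlap_le:
  assumes G: "centered_gaussian M {0..L} X (limit_cov \<rho>)" and \<rho>: "0 \<le> \<rho>" "\<rho> \<le> 1" and n: "n \<ge> 1"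
    and b: "\<And>l. l \<in> {0..L} \<Longrightarrow> b l \<ge> 0"
    and int: "integrable M (\<lambda>\<omega>. exp (\<Sum>l\<in>{0..L}. b l * (X l \<omega>)\<^sup>2))"
  shows "measure_pmf.expectation (pair_pmf (label_pmf n L \<rho>) (label_pmf n L \<rho>))
      (\<lambda>\<omega>. exp (\<Sum>l\<in>{0..L}. b l * (overlap n l \<omega> / sqrt n)\<^sup>2)) \<le> (\<integral>\<omega>. exp (\<Sum>l\<in>{0..L}. b l * (X l \<omega>)\<^sup>2) \<partial>M)"
proof -
  let ?W = "pair_pmf (label_pmf n L \<rho>) (label_pmf n L \<rho>)"
  let ?E = "measure_pmf.expectation ?W"
  define S where "S \<omega> = (\<Sum>l\<in>{0..L}. b l * (overlap n l \<omega> / sqrt n)\<^sup>2)" for \<omega>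
  define Q where "Q \<omega> = (\<Sum>l\<in>{0..L}. b l * (X l \<omega>)\<^sup>2)" for \<omega>
  have fin: "finite (set_pmf ?W)" by (simp add: finite_set_label_pmf)
  have finite_sum: "?E f = (\<Sum>\<omega>\<in>set_pmf ?W. f \<omega> * pmf ?W \<omega>)" for f
    using fin by (intro integral_measure_pmf_real) auto
  have "(\<lambda>N. \<Sum>k<N. x ^ k / fact k) \<longlonglongrightarrow> exp x" for x :: real
    using exp_converges[of x] by (simp add: sums_def divide_inverse mult.commute)
  then have "(\<lambda>N. ?E (\<lambda>\<omega>. \<Sum>k<N. S \<omega> ^ k / fact k)) \<longlonglongrightarrow> ?E (\<lambda>\<omega>. exp (S \<omega>))"
    unfolding finite_sum by (intro tendsto_sum tendsto_mult tendsto_const)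
  moreover have "?E (\<lambda>\<omega>. \<Sum>k<N. S \<omega> ^ k / fact k) \<le> (\<integral>\<omega>. exp (Q \<omega>) \<partial>M)" for N
  proof -
    have "?E (\<lambda>\<omega>. \<Sum>k<N. S \<omega> ^ k / fact k) = (\<Sum>k<N. ?E (\<lambda>\<omega>. S \<omega> ^ k) / fact k)"
      using fin by (subst Bochner_Integration.integral_sum) (simp_all add: integrable_measure_pmf_finite)
    also have "\<dots> \<le> (\<Sum>k<N. (\<integral>\<omega>. Q \<omega> ^ k \<partial>M) / fact k)"
      using expectation_overlap_quadratic_power_le(1)[OF G \<rho> n b]
      by (intro sum_mono divide_right_mono) (auto simp: S_def Q_def)
    also have "\<dots> = (\<integral>\<omega>. (\<Sum>k<N. Q \<omega> ^ k / fact k) \<partial>M)"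
      using expectation_overlap_quadratic_power_le(2)[OF G \<rho> n b]
      by (subst Bochner_Integration.integral_sum) (auto simp: Q_def)
    also have "\<dots> \<le> (\<integral>\<omega>. exp (Q \<omega>) \<partial>M)"
    \<comment> \<open>Integrability of the Gaussian exponential is used here.\<close>
    proof (rule integral_mono)
      show "integrable M (\<lambda>\<omega>. \<Sum>k<N. Q \<omega> ^ k / fact k)"
        using expectation_overlap_quadratic_power_le(2)[OF G \<rho> n b]
        by (intro Bochner_Integration.integrable_sum) (auto simp: Q_def)
      show "integrable M (\<lambda>\<omega>. exp (Q \<omega>))" using int by (simp add: Q_def)
      show "(\<Sum>k<N. Q \<omega> ^ k / fact k) \<le> exp (Q \<omega>)" for \<omega>
        using b by (intro exp_partial_sum_le) (auto simp: Q_def intro!: sum_nonneg)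
    qed
    finally show ?thesis .
  qed
  ultimately have "?E (\<lambda>\<omega>. exp (S \<omega>)) \<le> (\<integral>\<omega>. exp (Q \<omega>) \<partial>M)"
    by (intro LIMSEQ_le_const2) auto
  then show ?thesis by (simp add: S_def Q_def)
qed

section \<open>Integrability of the Gaussian exponential\<close>

text \<open>The covariance is the rank-one matrix of the vector
  \<open>(corr \<rho> i)\<^sup>2\<close> plus a diagonal correction that restores the entries
  1.\<close>

lemma limit_cov_quadratic_form:
  assumes "finite I"
  shows "(\<Sum>i\<in>I. \<Sum>j\<in>I. a i * a j * limit_cov \<rho> i j)
     = (\<Sum>i\<in>I. (corr \<rho> i)\<^sup>2 * a i)\<^sup>2 + (\<Sum>i\<in>I. (1 - (corr \<rho> i) ^ 4) * (a i)\<^sup>2)"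
proof -
  let ?w = "\<lambda>i. (corr \<rho> i)\<^sup>2"
  have "a i * a j * limit_cov \<rho> i j
      = (?w i * a i) * (?w j * a j) + (if j = i then (1 - (corr \<rho> i) ^ 4) * (a i)\<^sup>2 else 0)" for i j
    by (simp add: limit_cov_def power_mult_distrib algebra_simps power2_eq_square power4_eq_xxxx)
  then have "(\<Sum>i\<in>I. \<Sum>j\<in>I. a i * a j * limit_cov \<rho> i j)
      = (\<Sum>i\<in>I. \<Sum>j\<in>I. (?w i * a i) * (?w j * a j))
        + (\<Sum>i\<in>I. \<Sum>j\<in>I. if j = i then (1 - (corr \<rho> i) ^ 4) * (a i)\<^sup>2 else 0)"
    by (simp only: sum.distrib)
  also have "\<dots> = (\<Sum>i\<in>I. ?w i * a i)\<^sup>2 + (\<Sum>i\<in>I. (1 - (corr \<rho> i) ^ 4) * (a i)\<^sup>2)"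
    using assms by (simp add: power2_eq_square sum_product)
  finally show ?thesis .
qed

text \<open>Cauchy-Schwarz on the rank-one part, weighted by the denominators \<open>d i\<close>.
  The diagonal part contributes \<open>1 - d i\<close>, so the total coefficient is
  \<open>\<theta> * d i + 1 - d i\<close>, below 1 when \<open>\<theta> < 1\<close>.\<close>

lemma limit_cov_quadratic_form_le:
  assumes I: "finite I" and b: "\<And>i. i \<in> I \<Longrightarrow> b i \<ge> 0"
    and d: "\<And>i. i \<in> I \<Longrightarrow> 1 - (1 - corr \<rho> i ^ 4) * b i > 0"
    and \<theta>: "\<theta> = (\<Sum>i\<in>I. corr \<rho> i ^ 4 * b i / (1 - (1 - corr \<rho> i ^ 4) * b i))"
  shows "(\<Sum>i\<in>I. \<Sum>j\<in>I. (sqrt (b i) * x i) * (sqrt (b j) * x j) * limit_cov \<rho> i j)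
     \<le> (\<Sum>i\<in>I. (1 - (1 - \<theta>) * (1 - (1 - corr \<rho> i ^ 4) * b i)) * (x i)\<^sup>2)"
proof -
  define d where "d i = 1 - (1 - corr \<rho> i ^ 4) * b i" for i
  have dpos: "d i > 0" if "i \<in> I" for i using that assms(3) by (simp add: d_def)
  have "(\<Sum>i\<in>I. (corr \<rho> i)\<^sup>2 * (sqrt (b i) * x i))\<^sup>2
      = (\<Sum>i\<in>I. ((corr \<rho> i)\<^sup>2 * sqrt (b i) / sqrt (d i)) * (sqrt (d i) * x i))\<^sup>2"
    using dpos by (intro arg_cong[where f = "\<lambda>x. x\<^sup>2"] sum.cong refl) (simp add: less_imp_neq[symmetric])
  also have "\<dots> \<le> (\<Sum>i\<in>I. ((corr \<rho> i)\<^sup>2 * sqrt (b i) / sqrt (d i))\<^sup>2) * (\<Sum>i\<in>I. (sqrt (d i) * x i)\<^sup>2)"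
    by (rule Cauchy_Schwarz_ineq_sum)
  also have "(\<Sum>i\<in>I. ((corr \<rho> i)\<^sup>2 * sqrt (b i) / sqrt (d i))\<^sup>2) = \<theta>"
    unfolding \<theta> using dpos b
    by (intro sum.cong refl) (simp add: power_mult_distrib power_divide d_def[symmetric] less_imp_le flip: power_mult)
  also have "(\<Sum>i\<in>I. (sqrt (d i) * x i)\<^sup>2) = (\<Sum>i\<in>I. d i * (x i)\<^sup>2)"
    using dpos by (intro sum.cong refl) (simp add: power_mult_distrib less_imp_le)
  finally have "(\<Sum>i\<in>I. (corr \<rho> i)\<^sup>2 * (sqrt (b i) * x i))\<^sup>2 \<le> \<theta> * (\<Sum>i\<in>I. d i * (x i)\<^sup>2)" .
  moreover have "(\<Sum>i\<in>I. (1 - corr \<rho> i ^ 4) * (sqrt (b i) * x i)\<^sup>2) = (\<Sum>i\<in>I. (1 - d i) * (x i)\<^sup>2)"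
    using b by (intro sum.cong refl) (simp add: power_mult_distrib d_def)
  moreover have "\<theta> * (\<Sum>i\<in>I. d i * (x i)\<^sup>2) + (\<Sum>i\<in>I. (1 - d i) * (x i)\<^sup>2) = (\<Sum>i\<in>I. (1 - (1 - \<theta>) * d i) * (x i)\<^sup>2)"
    by (simp add: sum_distrib_left algebra_simps flip: sum.distrib)
  ultimately show ?thesis
    unfolding limit_cov_quadratic_form[OF I] d_def[symmetric] by linarith
qed

text \<open>Linearizing every square by \<open>exp (a\<^sup>2 / 2) = E exp (a \<xi>)\<close> with a standard Gaussian \<open>\<xi>\<close>
  and exchanging the expectations turns the covariance of \<open>X\<close> into a quadratic form in the \<open>\<xi>\<close>s.\<close>

lemma integrable_exp_quadratic:
  assumes G: "centered_gaussian M {0..L} X (limit_cov \<rho>)"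
    and b: "\<And>l. l \<in> {0..L} \<Longrightarrow> b l \<ge> 0"
    and d: "\<And>l. l \<in> {0..L} \<Longrightarrow> 1 - (1 - corr \<rho> l ^ 4) * b l > 0"
    and \<theta>: "(\<Sum>l\<in>{0..L}. corr \<rho> l ^ 4 * b l / (1 - (1 - corr \<rho> l ^ 4) * b l)) < 1"
  shows "integrable M (\<lambda>\<omega>. exp (\<Sum>l\<in>{0..L}. b l / 2 * (X l \<omega>)\<^sup>2))"
proof -
  interpret centered_gaussian M "{0..L}" X "limit_cov \<rho>" by fact
  define \<theta> where "\<theta> = (\<Sum>l\<in>{0..L}. corr \<rho> l ^ 4 * b l / (1 - (1 - corr \<rho> l ^ 4) * b l))"
  define \<eta> where "\<eta> l = 1 - (1 - \<theta>) * (1 - (1 - corr \<rho> l ^ 4) * b l)" for l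
  have \<eta>: "\<eta> l < 1" if "l \<in> {0..L}" for l
    using d[OF that] \<theta> by (simp add: \<eta>_def \<theta>_def)
  define N where "N = gaussian_measure 0 1"
  have setsN [measurable_cong]: "sets N = sets borel" by (simp add: N_def)
  interpret N: prob_space N unfolding N_def by (rule prob_space_gaussian_measure) simp
  interpret PS: product_sigma_finite "\<lambda>_ :: nat. N" by standard
  let ?Xi = "PiM {0..L} (\<lambda>_. N)"
  interpret Xi: prob_space ?Xi by (rule prob_space_PiM) (rule N.prob_space_axioms)
  interpret pair_sigma_finite M ?Xi by standard
  have [measurable]: "X l \<in> borel_measurable M" if "l \<in> {0..L}" for l
    using that by (rule measurable_X)
  have [measurable]: "(\<lambda>\<omega>. exp (\<Sum>l\<in>{0..L}. b l / 2 * (X l \<omega>)\<^sup>2)) \<in> borel_measurable M"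
    by measurable
  \<comment> \<open>One independent standard Gaussian for each square; the product measure merges
    the one-dimensional integrals.\<close>
  have linearize: "ennreal (exp (\<Sum>l\<in>{0..L}. b l / 2 * (X l \<omega>)\<^sup>2))
      = (\<integral>\<^sup>+\<xi>. (\<Prod>l\<in>{0..L}. ennreal (exp (sqrt (b l) * X l \<omega> * \<xi> l))) \<partial>?Xi)" for \<omega>
  proof -
    have "ennreal (exp (\<Sum>l\<in>{0..L}. b l / 2 * (X l \<omega>)\<^sup>2))
        = (\<Prod>l\<in>{0..L}. ennreal (exp ((sqrt (b l) * X l \<omega>)\<^sup>2 / 2)))"
    proof -
      have "(\<Sum>l\<in>{0..L}. b l / 2 * (X l \<omega>)\<^sup>2) = (\<Sum>l\<in>{0..L}. (sqrt (b l) * X l \<omega>)\<^sup>2 / 2)"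
      proof (rule sum.cong[OF refl])
        fix l assume "l \<in> {0..L}"
        from b[OF this] show "b l / 2 * (X l \<omega>)\<^sup>2 = (sqrt (b l) * X l \<omega>)\<^sup>2 / 2"
          by (simp add: power_mult_distrib)
      qed
      then show ?thesis by (simp only: exp_sum[OF finite_atLeastAtMost]) (simp add: prod_ennreal)
    qed
    also have "\<dots> = (\<Prod>l\<in>{0..L}. \<integral>\<^sup>+x. ennreal (exp (sqrt (b l) * X l \<omega> * x)) \<partial>N)"
      unfolding N_def by (simp add: nn_integral_gaussian_exp)
    also have "\<dots> = (\<integral>\<^sup>+\<xi>. (\<Prod>l\<in>{0..L}. ennreal (exp (sqrt (b l) * X l \<omega> * \<xi> l))) \<partial>?Xi)"
      by (rule PS.product_nn_integral_prod[symmetric]) simp_all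
    finally show ?thesis .
  qed
  have "(\<integral>\<^sup>+\<omega>. ennreal (exp (\<Sum>l\<in>{0..L}. b l / 2 * (X l \<omega>)\<^sup>2)) \<partial>M)
      = (\<integral>\<^sup>+\<omega>. (\<integral>\<^sup>+\<xi>. (\<Prod>l\<in>{0..L}. ennreal (exp (sqrt (b l) * X l \<omega> * \<xi> l))) \<partial>?Xi) \<partial>M)"
    by (simp only: linearize)
  \<comment> \<open>Tonelli: the integrands are nonnegative, so no integrability is
    presupposed.\<close>
  also have "\<dots> = (\<integral>\<^sup>+\<xi>. (\<integral>\<^sup>+\<omega>. (\<Prod>l\<in>{0..L}. ennreal (exp (sqrt (b l) * X l \<omega> * \<xi> l))) \<partial>M) \<partial>?Xi)"
    by (rule Fubini'[symmetric]) measurable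
  also have "\<dots> = (\<integral>\<^sup>+\<xi>. ennreal (exp (cov (\<lambda>l. sqrt (b l) * \<xi> l) (\<lambda>l. sqrt (b l) * \<xi> l) / 2)) \<partial>?Xi)"
  proof (rule nn_integral_cong)
    fix \<xi> :: "nat \<Rightarrow> real"
    have "(\<Prod>l\<in>{0..L}. ennreal (exp (sqrt (b l) * X l \<omega> * \<xi> l))) = ennreal (exp (lin (\<lambda>l. sqrt (b l) * \<xi> l) \<omega>))" for \<omega>
      by (simp add: prod_ennreal lin_def exp_sum mult_ac)
    then show "(\<integral>\<^sup>+\<omega>. (\<Prod>l\<in>{0..L}. ennreal (exp (sqrt (b l) * X l \<omega> * \<xi> l))) \<partial>M)
        = ennreal (exp (cov (\<lambda>l. sqrt (b l) * \<xi> l) (\<lambda>l. sqrt (b l) * \<xi> l) / 2))"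
      by (simp only: nn_integral_exp_lin)
  qed
  \<comment> \<open>The diagonal bound separates the coordinates, and \<open>\<eta> l < 1\<close>
    makes each factor finite.\<close>
  also have "\<dots> \<le> (\<integral>\<^sup>+\<xi>. (\<Prod>l\<in>{0..L}. ennreal (exp (\<eta> l * (\<xi> l)\<^sup>2 / 2))) \<partial>?Xi)"
  proof (rule nn_integral_mono)
    fix \<xi> :: "nat \<Rightarrow> real"
    have "cov (\<lambda>l. sqrt (b l) * \<xi> l) (\<lambda>l. sqrt (b l) * \<xi> l) \<le> (\<Sum>l\<in>{0..L}. \<eta> l * (\<xi> l)\<^sup>2)"
      unfolding cov_def \<eta>_def by (rule limit_cov_quadratic_form_le[OF _ b d \<theta>_def]) simp
    then have "exp (cov (\<lambda>l. sqrt (b l) * \<xi> l) (\<lambda>l. sqrt (b l) * \<xi> l) / 2) \<le> exp (\<Sum>l\<in>{0..L}. \<eta> l * (\<xi> l)\<^sup>2 / 2)"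
      by (simp flip: sum_divide_distrib)
    then show "ennreal (exp (cov (\<lambda>l. sqrt (b l) * \<xi> l) (\<lambda>l. sqrt (b l) * \<xi> l) / 2))
        \<le> (\<Prod>l\<in>{0..L}. ennreal (exp (\<eta> l * (\<xi> l)\<^sup>2 / 2)))"
      by (simp add: prod_ennreal exp_sum ennreal_leI)
  qed
  also have "\<dots> = (\<Prod>l\<in>{0..L}. \<integral>\<^sup>+x. ennreal (exp (\<eta> l * x\<^sup>2 / 2)) \<partial>N)"
    by (rule PS.product_nn_integral_prod) simp_all
  also have "\<dots> < \<infinity>"
    unfolding N_def using nn_integral_gaussian_exp_square_finite[OF \<eta>]
    by (simp add: ennreal_prod_eq_top less_top[symmetric])
  finally show ?thesis
    by (intro integrableI_bounded) simp_all
qed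

section \<open>Application to the given Gaussians\<close>

text \<open>Joint Gaussianity only asserts that some mean and deviation exist for each combination.
  They are recovered from its first two moments, which linearity reduces to the prescribed
  covariances; Gaussian marginals supply the integrability for this.\<close>

lemma limit_gaussians_centered_gaussian:
  assumes "limit_gaussians M L \<rho> U V"
  shows "centered_gaussian M {0..L} (V(0 := U)) (limit_cov \<rho>)"
proof -
  let ?X = "V(0 := U)"
  have jg: "prob_space M" "\<And>i. i \<in> {0..L} \<Longrightarrow> ?X i \<in> borel_measurable M"
    "\<And>c. \<exists>m \<sigma>. \<sigma> \<ge> 0 \<and> distr M borel (\<lambda>\<omega>. \<Sum>i\<in>{0..L}. c i * ?X i \<omega>) = gaussian_measure m \<sigma>"
    using assms unfolding limit_gaussians_def jointly_gaussian_def by blast+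
  interpret prob_space M by fact
  have comb: "(\<lambda>\<omega>. \<Sum>i\<in>{0..L}. c i * ?X i \<omega>) \<in> borel_measurable M" for c
    using jg(2) by (intro borel_measurable_sum borel_measurable_times) auto
  have momX: "all_moments M (?X i)" if i: "i \<in> {0..L}" for i
  proof -
    \<comment> \<open>A unit coefficient vector yields the marginal law.\<close>
    obtain m \<sigma> where \<sigma>: "\<sigma> \<ge> 0"
      "distr M borel (\<lambda>\<omega>. \<Sum>j\<in>{0..L}. (if j = i then 1 else 0) * ?X j \<omega>) = gaussian_measure m \<sigma>"
      using jg(3)[of "\<lambda>j. if j = i then 1 else 0"] by blast
    have "(\<lambda>\<omega>. \<Sum>j\<in>{0..L}. (if j = i then 1 else 0) * ?X j \<omega>) = ?X i"
      using i by (simp add: if_distrib[of "\<lambda>x. x * _"] cong: if_cong)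
    with \<sigma>(2) have D: "distr M borel (?X i) = gaussian_measure m \<sigma>" by simp
    have "integrable M (\<lambda>\<omega>. ?X i \<omega> ^ k)" for k
      using integrable_gaussian_power[OF \<sigma>(1), of m k] jg(2)[OF i]
      by (subst integrable_distr_eq[symmetric, of _ _ borel "\<lambda>x. x ^ k"]) (simp_all only: D, simp_all)
    then show ?thesis using jg(2)[OF i] by (simp only: all_moments_def) blast
  qed
  have momXX: "integrable M (\<lambda>\<omega>. ?X i \<omega> * ?X j \<omega>)" if "i \<in> {0..L}" "j \<in> {0..L}" for i j
    by (intro all_moments_integrable all_moments_mult momX that)
  have mean: "expectation (?X i) = 0" if "i \<in> {0..L}" for i
    using assms that by (cases "i = 0") (auto simp: limit_gaussians_def)
  have second: "expectation (\<lambda>\<omega>. ?X i \<omega> * ?X j \<omega>) = limit_cov \<rho> i j" if "i \<in> {0..L}" "j \<in> {0..L}" for i j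
    using assms that
    by (cases "i = 0"; cases "j = 0"; cases "i = j")
      (auto simp: limit_gaussians_def limit_cov_def corr_def power2_eq_square power4_eq_xxxx mult_ac)
  show ?thesis
  proof
    fix c :: "nat \<Rightarrow> real"
    let ?Y = "\<lambda>\<omega>. \<Sum>i\<in>{0..L}. c i * ?X i \<omega>"
    obtain m \<sigma> where \<sigma>: "\<sigma> \<ge> 0" and D: "distr M borel ?Y = gaussian_measure m \<sigma>"
      using jg(3)[of c] by blast
    have "m = (\<integral>x. x \<partial>distr M borel ?Y)"
      unfolding D by (rule integral_gaussian_mean[OF \<sigma>, symmetric])
    also have "\<dots> = expectation ?Y"
      using comb by (subst integral_distr) simp_all
    also have "\<dots> = (\<Sum>i\<in>{0..L}. c i * expectation (?X i))"
      by (subst Bochner_Integration.integral_sum)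
        (intro integrable_mult_right all_moments_integrable momX, assumption, simp only: integral_mult_right_zero)
    also have "\<dots> = 0" by (simp only: mean mult_zero_right sum.neutral_const cong: sum.cong)
    finally have m: "m = 0" .
    have "\<sigma>\<^sup>2 = (\<integral>x. x ^ (2 * 1) \<partial>distr M borel ?Y)"
      unfolding D m integral_gaussian_even_power[OF \<sigma>] by simp
    also have "\<dots> = expectation (\<lambda>\<omega>. (?Y \<omega>)\<^sup>2)"
      using comb by (subst integral_distr) simp_all
    also have "\<dots> = expectation (\<lambda>\<omega>. \<Sum>i\<in>{0..L}. \<Sum>j\<in>{0..L}. (c i * c j) * (?X i \<omega> * ?X j \<omega>))"
      unfolding power2_eq_square sum_product by (simp only: mult_ac)
    also have "\<dots> = (\<Sum>i\<in>{0..L}. expectation (\<lambda>\<omega>. \<Sum>j\<in>{0..L}. (c i * c j) * (?X i \<omega> * ?X j \<omega>)))"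
      by (intro Bochner_Integration.integral_sum Bochner_Integration.integrable_sum integrable_mult_right momXX)
    also have "\<dots> = (\<Sum>i\<in>{0..L}. \<Sum>j\<in>{0..L}. (c i * c j) * expectation (\<lambda>\<omega>. ?X i \<omega> * ?X j \<omega>))"
    proof (rule sum.cong[OF refl])
      fix i assume "i \<in> {0..L}"
      then show "expectation (\<lambda>\<omega>. \<Sum>j\<in>{0..L}. (c i * c j) * (?X i \<omega> * ?X j \<omega>))
          = (\<Sum>j\<in>{0..L}. (c i * c j) * expectation (\<lambda>\<omega>. ?X i \<omega> * ?X j \<omega>))"
        by (subst Bochner_Integration.integral_sum)
          (intro integrable_mult_right momXX, assumption+, simp only: integral_mult_right_zero)
    qed
    also have "\<dots> = (\<Sum>i\<in>{0..L}. \<Sum>j\<in>{0..L}. c i * c j * limit_cov \<rho> i j)"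
      by (intro sum.cong refl) (simp only: second)
    finally show "\<exists>\<sigma>\<ge>0. \<sigma>\<^sup>2 = (\<Sum>i\<in>{0..L}. \<Sum>j\<in>{0..L}. c i * c j * limit_cov \<rho> i j) \<and>
        distr M borel ?Y = gaussian_measure 0 \<sigma>"
      using \<sigma> D m by blast
  qed (use jg(2) in \<open>auto simp: limit_cov_def mult.commute\<close>)
qed

lemma limit_gaussians_overlap_moments:
  assumes V: "limit_gaussians M L \<rho> U V" and \<rho>: "0 \<le> \<rho>" "\<rho> \<le> 1" and n: "n \<ge> 1"
  shows "integrable M (\<lambda>\<omega>. U \<omega> ^ (2 * \<alpha>) * (\<Prod>l=1..L. V l \<omega> ^ (2 * \<alpha>s l)))"
    and "measure_pmf.expectation (pair_pmf (label_pmf n L \<rho>) (label_pmf n L \<rho>))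
          (\<lambda>((x, xs), (x', xs')).
             (inner_prod n x x' / sqrt (real n)) ^ (2 * \<alpha>) *
             (\<Prod>l=1..L. (inner_prod n (xs l) (xs' l) / sqrt (real n)) ^ (2 * \<alpha>s l)))
        \<le> (\<integral>\<omega>. U \<omega> ^ (2 * \<alpha>) * (\<Prod>l=1..L. V l \<omega> ^ (2 * \<alpha>s l)) \<partial>M)"
proof -
  note G = limit_gaussians_centered_gaussian[OF V]
  have zero: "{0..L} = insert 0 {1..L}" by auto
  define a where "a = \<alpha>s(0 := \<alpha>)"
  have split: "(\<Prod>l\<in>{0..L}. (V(0 := U)) l \<omega> ^ (2 * a l)) = U \<omega> ^ (2 * \<alpha>) * (\<Prod>l=1..L. V l \<omega> ^ (2 * \<alpha>s l))" for \<omega>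
    by (simp add: zero a_def)
  show "integrable M (\<lambda>\<omega>. U \<omega> ^ (2 * \<alpha>) * (\<Prod>l=1..L. V l \<omega> ^ (2 * \<alpha>s l)))"
    using centered_gaussian.integrable_prod_power[OF G, of "\<lambda>l. 2 * a l"] unfolding split .
  have "(\<lambda>((x, xs), (x', xs')). (inner_prod n x x' / sqrt (real n)) ^ (2 * \<alpha>) *
           (\<Prod>l=1..L. (inner_prod n (xs l) (xs' l) / sqrt (real n)) ^ (2 * \<alpha>s l)))
      = (\<lambda>\<omega>. \<Prod>l\<in>{0..L}. (overlap n l \<omega> / sqrt n) ^ (2 * a l))"
    by (rule ext) (simp add: zero a_def overlap_def label_def case_prod_beta)
  then show "measure_pmf.expectation (pair_pmf (label_pmf n L \<rho>) (label_pmf n L \<rho>))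
          (\<lambda>((x, xs), (x', xs')).
             (inner_prod n x x' / sqrt (real n)) ^ (2 * \<alpha>) *
             (\<Prod>l=1..L. (inner_prod n (xs l) (xs' l) / sqrt (real n)) ^ (2 * \<alpha>s l)))
        \<le> (\<integral>\<omega>. U \<omega> ^ (2 * \<alpha>) * (\<Prod>l=1..L. V l \<omega> ^ (2 * \<alpha>s l)) \<partial>M)"
    using expectation_overlap_powers_le[OF G \<rho> n, of a] by (simp only: split)
qed

text \<open>With \<open>b0\<close> placed at index 0, the condition \<open>b_sum\<close> becomes the
  single bound on the sum over 0 to L: there the correlation is 1, the denominator is 1 and the
  fraction is \<open>b0\<close>.\<close>

lemma limit_gaussians_overlap_exp:
  assumes V: "limit_gaussians M L \<rho> U V" and \<rho>: "0 \<le> \<rho>" "\<rho> \<le> 1" and n: "n \<ge> 1"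
    and b0: "b0 \<ge> 0" and b: "\<And>l. l \<in> {1..L} \<Longrightarrow> 0 \<le> b l" "\<And>l. l \<in> {1..L} \<Longrightarrow> b l < 1"
    and b_sum: "b0 + (\<Sum>l=1..L. \<rho> ^ 4 * b l / (1 - (1 - \<rho> ^ 4) * b l)) < 1"
  shows "integrable M (\<lambda>\<omega>. exp (b0 / 2 * (U \<omega>)\<^sup>2 + (\<Sum>l=1..L. b l / 2 * (V l \<omega>)\<^sup>2)))"
    and "measure_pmf.expectation (pair_pmf (label_pmf n L \<rho>) (label_pmf n L \<rho>))
          (\<lambda>((x, xs), (x', xs')).
             exp (b0 / 2 * (inner_prod n x x' / sqrt (real n))\<^sup>2 +
                  (\<Sum>l=1..L. b l / 2 * (inner_prod n (xs l) (xs' l) / sqrt (real n))\<^sup>2)))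
        \<le> (\<integral>\<omega>. exp (b0 / 2 * (U \<omega>)\<^sup>2 + (\<Sum>l=1..L. b l / 2 * (V l \<omega>)\<^sup>2)) \<partial>M)"
proof -
  note G = limit_gaussians_centered_gaussian[OF V]
  have zero: "{0..L} = insert 0 {1..L}" by auto
  define c where "c = b(0 := b0)"
  have c_nonneg: "c l \<ge> 0" if "l \<in> {0..L}" for l
    using that b b0 by (cases "l = 0") (auto simp: c_def)
  have half: "c l / 2 \<ge> 0" if "l \<in> {0..L}" for l
    using c_nonneg[OF that] by simp
  have denom: "1 - (1 - corr \<rho> l ^ 4) * c l > 0" if "l \<in> {0..L}" for l
  proof (cases "l = 0")
    case False
    then have l: "l \<in> {1..L}" using that by simp
    \<comment> \<open>Hence the denominator is at least \<open>1 - b l\<close>, which is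
      positive.\<close>
    have "(1 - \<rho> ^ 4) * b l \<le> 1 * b l"
      using b(1)[OF l] \<rho> by (intro mult_right_mono) auto
    then show ?thesis using False b(2)[OF l] by (simp add: corr_def c_def)
  qed (simp add: corr_def)
  have "(\<Sum>l=1..L. corr \<rho> l ^ 4 * c l / (1 - (1 - corr \<rho> l ^ 4) * c l))
      = (\<Sum>l=1..L. \<rho> ^ 4 * b l / (1 - (1 - \<rho> ^ 4) * b l))"
    by (intro sum.cong refl) (simp add: corr_def c_def)
  then have \<theta>: "(\<Sum>l\<in>{0..L}. corr \<rho> l ^ 4 * c l / (1 - (1 - corr \<rho> l ^ 4) * c l)) < 1"
    using b_sum by (simp add: zero corr_def c_def)
  have split: "(\<Sum>l\<in>{0..L}. c l / 2 * (g l)\<^sup>2) = b0 / 2 * (g 0)\<^sup>2 + (\<Sum>l=1..L. b l / 2 * (g l)\<^sup>2)" for g :: "nat \<Rightarrow> real"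
  proof -
    have "(\<Sum>l=1..L. c l / 2 * (g l)\<^sup>2) = (\<Sum>l=1..L. b l / 2 * (g l)\<^sup>2)"
      by (intro sum.cong refl) (simp add: c_def)
    then show ?thesis by (simp add: zero c_def)
  qed
  have splitV: "(\<Sum>l\<in>{0..L}. c l / 2 * ((V(0 := U)) l \<omega>)\<^sup>2) = b0 / 2 * (U \<omega>)\<^sup>2 + (\<Sum>l=1..L. b l / 2 * (V l \<omega>)\<^sup>2)" for \<omega>
    unfolding split[of "\<lambda>l. (V(0 := U)) l \<omega>"] by simp
  have int: "integrable M (\<lambda>\<omega>. exp (\<Sum>l\<in>{0..L}. c l / 2 * ((V(0 := U)) l \<omega>)\<^sup>2))"
    by (rule integrable_exp_quadratic[OF G c_nonneg denom \<theta>])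
  then show "integrable M (\<lambda>\<omega>. exp (b0 / 2 * (U \<omega>)\<^sup>2 + (\<Sum>l=1..L. b l / 2 * (V l \<omega>)\<^sup>2)))"
    unfolding splitV .
  have "(\<lambda>((x, xs), (x', xs')).
             exp (b0 / 2 * (inner_prod n x x' / sqrt (real n))\<^sup>2 +
                  (\<Sum>l=1..L. b l / 2 * (inner_prod n (xs l) (xs' l) / sqrt (real n))\<^sup>2)))
        = (\<lambda>\<omega>. exp (\<Sum>l\<in>{0..L}. c l / 2 * (overlap n l \<omega> / sqrt n)\<^sup>2))"
    unfolding split by (rule ext) (simp add: overlap_def label_def case_prod_beta)
  then show "measure_pmf.expectation (pair_pmf (label_pmf n L \<rho>) (label_pmf n L \<rho>))
          (\<lambda>((x, xs), (x', xs')).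
             exp (b0 / 2 * (inner_prod n x x' / sqrt (real n))\<^sup>2 +
                  (\<Sum>l=1..L. b l / 2 * (inner_prod n (xs l) (xs' l) / sqrt (real n))\<^sup>2)))
        \<le> (\<integral>\<omega>. exp (b0 / 2 * (U \<omega>)\<^sup>2 + (\<Sum>l=1..L. b l / 2 * (V l \<omega>)\<^sup>2)) \<partial>M)"
    using expectation_exp_overlap_le[OF G \<rho> n half int] by (simp only: splitV)
qed

text \<open>The integrability claims ensure that the right-hand sides are genuine expectations and
  not the default value 0.\<close>

theorem lemma2p5:
  fixes n L :: nat and \<rho> :: real
    and M :: "'a measure" and U :: "'a \<Rightarrow> real" and V :: "nat \<Rightarrow> 'a \<Rightarrow> real"
  assumes "n \<ge> 1" and "L \<ge> 1"
    and "0 < \<rho>" and "\<rho> \<le> 1"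
    and "limit_gaussians M L \<rho> U V"
  shows
    "(\<forall>(\<alpha> :: nat) (\<alpha>s :: nat \<Rightarrow> nat).
        integrable M (\<lambda>\<omega>. U \<omega> ^ (2 * \<alpha>) * (\<Prod>l=1..L. V l \<omega> ^ (2 * \<alpha>s l))) \<and>
        measure_pmf.expectation (pair_pmf (label_pmf n L \<rho>) (label_pmf n L \<rho>))
          (\<lambda>((x, xs), (x', xs')).
             (inner_prod n x x' / sqrt (real n)) ^ (2 * \<alpha>) *
             (\<Prod>l=1..L. (inner_prod n (xs l) (xs' l) / sqrt (real n)) ^ (2 * \<alpha>s l)))
        \<le> (\<integral>\<omega>. U \<omega> ^ (2 * \<alpha>) * (\<Prod>l=1..L. V l \<omega> ^ (2 * \<alpha>s l)) \<partial>M))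
     \<and>
     (\<forall>(\<mu> :: real) (\<gamma> :: real) (lam :: nat \<Rightarrow> real) (\<epsilon> :: nat \<Rightarrow> real) (\<delta> :: real) (\<iota> :: real) (t :: real).
        \<mu> > 0 \<and> \<gamma> > 0 \<and>
        (\<forall>l\<in>{1..L}. lam l > 0 \<and> 0 < \<epsilon> l \<and> \<epsilon> l < 1) \<and>
        \<delta> > 0 \<and>
        max (\<mu>\<^sup>2 / \<gamma>)
          (max (MAX l\<in>{1..L}. (\<epsilon> l)\<^sup>2 * lam l)
             (\<mu>\<^sup>2 / \<gamma> + (\<Sum>l=1..L. \<rho> ^ 4 * (\<epsilon> l)\<^sup>2 * lam l / (1 - (1 - \<rho> ^ 4) * (\<epsilon> l)\<^sup>2 * lam l))))
          \<le> 1 - \<delta> \<and>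
        0 < \<iota> \<and> \<iota> < 1 \<and>
        (1 + \<iota>)\<^sup>2 * \<mu>\<^sup>2 / \<gamma> < 1 \<and>
        (1 + \<iota>)\<^sup>2 * \<mu>\<^sup>2 / \<gamma> +
          (\<Sum>l=1..L. \<rho> ^ 4 * (\<epsilon> l)\<^sup>2 * lam l / (1 - (1 - \<rho> ^ 4) * (\<epsilon> l)\<^sup>2 * lam l)) < 1 \<and>
        \<bar>t\<bar> \<le> \<iota>
        \<longrightarrow>
        integrable M (\<lambda>\<omega>. exp ((1 + t)\<^sup>2 * \<mu>\<^sup>2 / (2 * \<gamma>) * (U \<omega>)\<^sup>2 +
                              (\<Sum>l=1..L. (\<epsilon> l)\<^sup>2 * lam l / 2 * (V l \<omega>)\<^sup>2))) \<and>
        measure_pmf.expectation (pair_pmf (label_pmf n L \<rho>) (label_pmf n L \<rho>))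
          (\<lambda>((x, xs), (x', xs')).
             exp ((1 + t)\<^sup>2 * \<mu>\<^sup>2 / (2 * \<gamma>) * (inner_prod n x x' / sqrt (real n))\<^sup>2 +
                  (\<Sum>l=1..L. (\<epsilon> l)\<^sup>2 * lam l / 2 *
                     (inner_prod n (xs l) (xs' l) / sqrt (real n))\<^sup>2)))
        \<le> (\<integral>\<omega>. exp ((1 + t)\<^sup>2 * \<mu>\<^sup>2 / (2 * \<gamma>) * (U \<omega>)\<^sup>2 +
                      (\<Sum>l=1..L. (\<epsilon> l)\<^sup>2 * lam l / 2 * (V l \<omega>)\<^sup>2)) \<partial>M))"
proof (intro conjI allI impI)
  have \<rho>: "0 \<le> \<rho>" "\<rho> \<le> 1" using assms by simp_all
  fix \<alpha> :: nat and \<alpha>s :: "nat \<Rightarrow> nat"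
  show "integrable M (\<lambda>\<omega>. U \<omega> ^ (2 * \<alpha>) * (\<Prod>l=1..L. V l \<omega> ^ (2 * \<alpha>s l)))"
    by (rule limit_gaussians_overlap_moments(1)[OF assms(5) \<rho> assms(1)])
  show "measure_pmf.expectation (pair_pmf (label_pmf n L \<rho>) (label_pmf n L \<rho>))
          (\<lambda>((x, xs), (x', xs')).
             (inner_prod n x x' / sqrt (real n)) ^ (2 * \<alpha>) *
             (\<Prod>l=1..L. (inner_prod n (xs l) (xs' l) / sqrt (real n)) ^ (2 * \<alpha>s l)))
        \<le> (\<integral>\<omega>. U \<omega> ^ (2 * \<alpha>) * (\<Prod>l=1..L. V l \<omega> ^ (2 * \<alpha>s l)) \<partial>M)"
    by (rule limit_gaussians_overlap_moments(2)[OF assms(5) \<rho> assms(1)])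
next
  have \<rho>: "0 \<le> \<rho>" "\<rho> \<le> 1" using assms by simp_all
  fix \<mu> \<gamma> :: real and lam \<epsilon> :: "nat \<Rightarrow> real" and \<delta> \<iota> t :: real
  assume H: "\<mu> > 0 \<and> \<gamma> > 0 \<and>
      (\<forall>l\<in>{1..L}. lam l > 0 \<and> 0 < \<epsilon> l \<and> \<epsilon> l < 1) \<and>
      \<delta> > 0 \<and>
      max (\<mu>\<^sup>2 / \<gamma>)
        (max (MAX l\<in>{1..L}. (\<epsilon> l)\<^sup>2 * lam l)
           (\<mu>\<^sup>2 / \<gamma> + (\<Sum>l=1..L. \<rho> ^ 4 * (\<epsilon> l)\<^sup>2 * lam l / (1 - (1 - \<rho> ^ 4) * (\<epsilon> l)\<^sup>2 * lam l))))
        \<le> 1 - \<delta> \<and>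
      0 < \<iota> \<and> \<iota> < 1 \<and>
      (1 + \<iota>)\<^sup>2 * \<mu>\<^sup>2 / \<gamma> < 1 \<and>
      (1 + \<iota>)\<^sup>2 * \<mu>\<^sup>2 / \<gamma> +
        (\<Sum>l=1..L. \<rho> ^ 4 * (\<epsilon> l)\<^sup>2 * lam l / (1 - (1 - \<rho> ^ 4) * (\<epsilon> l)\<^sup>2 * lam l)) < 1 \<and>
      \<bar>t\<bar> \<le> \<iota>"
  define b0 where "b0 = (1 + t)\<^sup>2 * \<mu>\<^sup>2 / \<gamma>"
  define b where "b l = (\<epsilon> l)\<^sup>2 * lam l" for l
  have b0: "b0 \<ge> 0" using H by (simp add: b0_def)
  have b: "0 \<le> b l" "b l < 1" if l: "l \<in> {1..L}" for l
  proof -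
    have "lam l > 0" using H l by blast
    then show "0 \<le> b l" by (simp add: b_def)
    have "b l \<le> (MAX l\<in>{1..L}. (\<epsilon> l)\<^sup>2 * lam l)"
      unfolding b_def using l by (intro Max_ge) auto
    also have "\<dots> \<le> 1 - \<delta>"
      using H unfolding max.bounded_iff by blast
    also have "\<dots> < 1" using H by simp
    finally show "b l < 1" .
  qed
  \<comment> \<open>The worst case over \<open>\<bar>t\<bar> \<le> \<iota>\<close> is
    \<open>t = \<iota>\<close>, where the smallness condition is assumed.\<close>
  have "\<bar>1 + t\<bar> \<le> \<bar>1 + \<iota>\<bar>" using H by auto
  then have "(1 + t)\<^sup>2 \<le> (1 + \<iota>)\<^sup>2" by (simp only: abs_le_square_iff)
  then have "b0 \<le> (1 + \<iota>)\<^sup>2 * \<mu>\<^sup>2 / \<gamma>"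
    using H by (auto simp: b0_def intro!: divide_right_mono mult_right_mono)
  then have b_sum: "b0 + (\<Sum>l=1..L. \<rho> ^ 4 * b l / (1 - (1 - \<rho> ^ 4) * b l)) < 1"
    using H unfolding b_def mult.assoc[symmetric] by linarith
  have half: "(1 + t)\<^sup>2 * \<mu>\<^sup>2 / (2 * \<gamma>) = b0 / 2"
    by (simp add: b0_def)
  show "integrable M (\<lambda>\<omega>. exp ((1 + t)\<^sup>2 * \<mu>\<^sup>2 / (2 * \<gamma>) * (U \<omega>)\<^sup>2 +
                            (\<Sum>l=1..L. (\<epsilon> l)\<^sup>2 * lam l / 2 * (V l \<omega>)\<^sup>2)))"
    unfolding half b_def[symmetric]
    by (rule limit_gaussians_overlap_exp(1)[OF assms(5) \<rho> assms(1) b0 b b_sum])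
  show "measure_pmf.expectation (pair_pmf (label_pmf n L \<rho>) (label_pmf n L \<rho>))
        (\<lambda>((x, xs), (x', xs')).
           exp ((1 + t)\<^sup>2 * \<mu>\<^sup>2 / (2 * \<gamma>) * (inner_prod n x x' / sqrt (real n))\<^sup>2 +
                (\<Sum>l=1..L. (\<epsilon> l)\<^sup>2 * lam l / 2 *
                   (inner_prod n (xs l) (xs' l) / sqrt (real n))\<^sup>2)))
      \<le> (\<integral>\<omega>. exp ((1 + t)\<^sup>2 * \<mu>\<^sup>2 / (2 * \<gamma>) * (U \<omega>)\<^sup>2 +
                    (\<Sum>l=1..L. (\<epsilon> l)\<^sup>2 * lam l / 2 * (V l \<omega>)\<^sup>2)) \<partial>M)"
    unfolding half b_def[symmetric]
    by (rule limit_gaussians_overlap_exp(2)[OF assms(5) \<rho> assms(1) b0 b b_sum])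
qed

end
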